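(* Let $(R,\mathfrak{m},k)$ be a one-dimensional Cohen-Macaulay local ring with infinite residue field $k$. Let $I\neq0$ be an ideal of $R$ that is Ulrich and Elias. Then $I$ is Burch.
   Context: Local rings are commutative and Noetherian. Let $(R,\mathfrak{m},k)$ be a one-dimensional Cohen-Macaulay local ring and $I$ an $\mathfrak{m}$-primary ideal. $I$ is Ulrich (as an $R$-module) if $\mu(I)=e(R)$, where $\mu(I)$ is the minimal number of generators of $I$ and $e(R)$ is the Hilbert-Samuel multiplicity of $R$; when $k$ is infinite this is equivalent to $xI=\mathfrak{m}I$ for some $x\in\mathfrak{m}$. $I$ is Elias if $\operatorname{type}_R(I)=\operatorname{type}_R(R/I)$, where $\operatorname{type}_R(M):=\dim_k\operatorname{Ext}_R^{\dim_R M}(k,M)$. (Being Ulrich or Elias includes being $\mathfrak{m}$-primary.) An ideal $I$ of a local ring $(R,\mathfrak{m})$ is Burch if $\mathfrak{m}I\neq\mathfrak{m}(I:_R\mathfrak{m})$. *)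

theory Defs
  imports
    "HOL-Algebra.QuotRing"
    "HOL-Algebra.Ideal_Product"
    "HOL-Algebra.Ring_Divisibility"
    "HOL-Library.Extended_Nat"
    "Jordan_Normal_Form.Missing_VectorSpace"
begin

locale noetherian_local_ring = cring R + noetherian_ring R for R (structure) +
  fixes m
  assumes maximal: "maximalideal m R"
    and unique_maximal: "maximalideal n R \<Longrightarrow> n = m"

definition krull_dim :: "('a, 'c) ring_scheme \<Rightarrow> enat" where
  "krull_dim R = (SUP n \<in> {n. \<exists>P. (\<forall>i\<le>n. primeideal (P i) R) \<and> (\<forall>i<n. P i \<subset> P (Suc i))}. enat n)"

definition regular_sequence :: "('a, 'c) ring_scheme \<Rightarrow> 'a list \<Rightarrow> bool" where
  "regular_sequence R xs \<longleftrightarrow>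
     set xs \<subseteq> carrier R \<and> Idl\<^bsub>R\<^esub> (set xs) \<noteq> carrier R \<and>
     (\<forall>i<length xs. \<forall>r\<in>carrier R.
        xs ! i \<otimes>\<^bsub>R\<^esub> r \<in> Idl\<^bsub>R\<^esub> (set (take i xs)) \<longrightarrow> r \<in> Idl\<^bsub>R\<^esub> (set (take i xs)))"

definition ring_depth :: "('a, 'c) ring_scheme \<Rightarrow> 'a set \<Rightarrow> enat" where
  "ring_depth R m = (SUP xs \<in> {xs. set xs \<subseteq> m \<and> regular_sequence R xs}. enat (length xs))"

definition cohen_macaulay :: "('a, 'c) ring_scheme \<Rightarrow> 'a set \<Rightarrow> bool" where
  "cohen_macaulay R m \<longleftrightarrow> ring_depth R m = krull_dim R"

definition ideal_colon :: "('a, 'c) ring_scheme \<Rightarrow> 'a set \<Rightarrow> 'a set \<Rightarrow> 'a set" where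
  "ideal_colon R I J = {r \<in> carrier R. \<forall>a\<in>J. r \<otimes>\<^bsub>R\<^esub> a \<in> I}"

definition ideal_radical :: "('a, 'c) ring_scheme \<Rightarrow> 'a set \<Rightarrow> 'a set" where
  "ideal_radical R I = {r \<in> carrier R. \<exists>n::nat. r [^]\<^bsub>R\<^esub> n \<in> I}"

definition primary_ideal :: "('a, 'c) ring_scheme \<Rightarrow> 'a set \<Rightarrow> bool" where
  "primary_ideal R I \<longleftrightarrow> ideal I R \<and> I \<noteq> carrier R \<and>
     (\<forall>a\<in>carrier R. \<forall>b\<in>carrier R. a \<otimes>\<^bsub>R\<^esub> b \<in> I \<longrightarrow> a \<in> I \<or> b \<in> ideal_radical R I)"

definition ideal_primary_to :: "('a, 'c) ring_scheme \<Rightarrow> 'a set \<Rightarrow> 'a set \<Rightarrow> bool" where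
  "ideal_primary_to R m I \<longleftrightarrow> primary_ideal R I \<and> ideal_radical R I = m"

definition ideal_pow :: "('a, 'c) ring_scheme \<Rightarrow> 'a set \<Rightarrow> nat \<Rightarrow> 'a set" where
  "ideal_pow R I n = ((ideal_prod R I) ^^ n) (carrier R)"

definition ideal_mu :: "('a, 'c) ring_scheme \<Rightarrow> 'a set \<Rightarrow> nat" where
  "ideal_mu R I = (LEAST n. \<exists>S. S \<subseteq> carrier R \<and> finite S \<and> card S = n \<and> Idl\<^bsub>R\<^esub> S = I)"

text \<open>The record type of modules extends that of rings; the fields \<open>mult\<close> and \<open>one\<close> play no
  role for modules and are left \<open>undefined\<close>.\<close>

text \<open>An ideal regarded as a module over the ring; \<open>carrier R\<close> gives the ring itself.\<close>

definition ideal_module :: "('a, 'c) ring_scheme \<Rightarrow> 'a set \<Rightarrow> ('a, 'a) module" where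
  "ideal_module R I = \<lparr>carrier = I, monoid.mult = undefined, one = undefined,
     zero = \<zero>\<^bsub>R\<^esub>, add = add R, smult = monoid.mult R\<rparr>"

definition quot_module :: "('a, 'b, 'c) module_scheme \<Rightarrow> 'b set \<Rightarrow> ('a, 'b set) module" where
  "quot_module M N = \<lparr>carrier = a_rcosets\<^bsub>M\<^esub> N, monoid.mult = undefined, one = undefined,
     zero = N, add = set_add M, smult = (\<lambda>r X. \<Union>x\<in>X. N +>\<^bsub>M\<^esub> (r \<odot>\<^bsub>M\<^esub> x))\<rparr>"

abbreviation quot_ring_module :: "('a, 'c) ring_scheme \<Rightarrow> 'a set \<Rightarrow> ('a, 'a set) module" where
  "quot_ring_module R I \<equiv> quot_module (ideal_module R (carrier R)) I"

definition annihilator :: "('a, 'c) ring_scheme \<Rightarrow> ('a, 'b, 'd) module_scheme \<Rightarrow> 'a set" where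
  "annihilator R M = {r \<in> carrier R. \<forall>x\<in>carrier M. r \<odot>\<^bsub>M\<^esub> x = \<zero>\<^bsub>M\<^esub>}"

definition module_dim :: "('a, 'c) ring_scheme \<Rightarrow> ('a, 'b, 'd) module_scheme \<Rightarrow> enat" where
  "module_dim R M = krull_dim (R Quot annihilator R M)"

definition module_length :: "('a, 'c) ring_scheme \<Rightarrow> ('a, 'b, 'd) module_scheme \<Rightarrow> enat" where
  "module_length R M =
     (SUP n \<in> {n. \<exists>N. (\<forall>i\<le>n. Module.submodule (N i) R M) \<and> (\<forall>i<n. N i \<subset> N (Suc i))}. enat n)"

text \<open>\<open>e(R) = lim d! \<ell>(R/m\<^sup>n) / n\<^sup>d\<close> with \<open>d = dim R\<close>.\<close>

definition hs_multiplicity :: "('a, 'c) ring_scheme \<Rightarrow> 'a set \<Rightarrow> real" where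
  "hs_multiplicity R m = (let d = the_enat (krull_dim R) in
     lim (\<lambda>n. fact d * real (the_enat (module_length R (quot_ring_module R (ideal_pow R m n))))
              / real n ^ d))"

text \<open>Homomorphisms are represented by functions that are \<open>undefined\<close> outside the carrier.\<close>

definition hom_module ::
  "('a, 'c) ring_scheme \<Rightarrow> ('a, 'b, 'd) module_scheme \<Rightarrow> ('a, 'e, 'f) module_scheme
     \<Rightarrow> ('a, 'b \<Rightarrow> 'e) module" where
  "hom_module R M N =
     \<lparr>carrier = LinearCombinations.module_hom R M N \<inter> extensional (carrier M),
      monoid.mult = undefined, one = undefined,
      zero = (\<lambda>x\<in>carrier M. \<zero>\<^bsub>N\<^esub>),
      add = (\<lambda>f g. \<lambda>x\<in>carrier M. f x \<oplus>\<^bsub>N\<^esub> g x),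
      smult = (\<lambda>r f. \<lambda>x\<in>carrier M. r \<odot>\<^bsub>N\<^esub> f x)\<rparr>"

abbreviation free_module :: "('a, 'c) ring_scheme \<Rightarrow> nat \<Rightarrow> ('a, nat \<Rightarrow> 'a) module" where
  "free_module R n \<equiv> ring.func_space R {..<n}"

text \<open>Exactness of \<open>\<dots> \<rightarrow> F 2 \<rightarrow> F 1 \<rightarrow> F 0 \<rightarrow> N \<rightarrow> 0\<close>, where \<open>F i\<close> is free of finite rank \<open>b i\<close>,
  the differential \<open>d i\<close> maps \<open>F (i + 1)\<close> to \<open>F i\<close>, and \<open>aug\<close> is the augmentation. Over a
  Noetherian ring every finitely generated module has such a resolution.\<close>

definition free_resolution ::
  "('a, 'c) ring_scheme \<Rightarrow> ('a, 'b, 'd) module_scheme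
     \<Rightarrow> (nat \<Rightarrow> nat) \<Rightarrow> (nat \<Rightarrow> (nat \<Rightarrow> 'a) \<Rightarrow> (nat \<Rightarrow> 'a)) \<Rightarrow> ((nat \<Rightarrow> 'a) \<Rightarrow> 'b) \<Rightarrow> bool" where
  "free_resolution R N b d aug \<longleftrightarrow>
     (\<forall>i. d i \<in> LinearCombinations.module_hom R (free_module R (b (Suc i))) (free_module R (b i))) \<and>
     aug \<in> LinearCombinations.module_hom R (free_module R (b 0)) N \<and>
     aug ` carrier (free_module R (b 0)) = carrier N \<and>
     d 0 ` carrier (free_module R (b (Suc 0))) = a_kernel (free_module R (b 0)) N aug \<and>
     (\<forall>i. d (Suc i) ` carrier (free_module R (b (Suc (Suc i)))) =
          a_kernel (free_module R (b (Suc i))) (free_module R (b i)) (d i))"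

text \<open>The \<open>i\<close>-th cohomology of \<open>Hom\<^sub>R(F, M)\<close>, where \<open>F\<close> is given by ranks \<open>b\<close> and maps \<open>d\<close>.\<close>

definition hom_cohomology ::
  "('a, 'c) ring_scheme \<Rightarrow> (nat \<Rightarrow> nat) \<Rightarrow> (nat \<Rightarrow> (nat \<Rightarrow> 'a) \<Rightarrow> (nat \<Rightarrow> 'a))
     \<Rightarrow> ('a, 'e, 'f) module_scheme \<Rightarrow> nat \<Rightarrow> ('a, ((nat \<Rightarrow> 'a) \<Rightarrow> 'e) set) module" where
  "hom_cohomology R b d M i =
     (let C = (\<lambda>j. hom_module R (free_module R (b j)) M);
          \<delta> = (\<lambda>j f. compose (carrier (free_module R (b (Suc j)))) f (d j))
      in quot_module ((C i)\<lparr>carrier := a_kernel (C i) (C (Suc i)) (\<delta> i)\<rparr>)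
           (case i of 0 \<Rightarrow> {\<zero>\<^bsub>C 0\<^esub>} | Suc j \<Rightarrow> \<delta> j ` carrier (C j)))"

text \<open>\<open>Ext\<^sup>i\<^sub>R(N, M)\<close> for finitely generated \<open>N\<close> over a Noetherian ring, computed from a chosen
  free resolution of \<open>N\<close>; a different choice gives an isomorphic module.\<close>

definition Ext_module ::
  "('a, 'c) ring_scheme \<Rightarrow> nat \<Rightarrow> ('a, 'b, 'd) module_scheme \<Rightarrow> ('a, 'e, 'f) module_scheme
     \<Rightarrow> ('a, ((nat \<Rightarrow> 'a) \<Rightarrow> 'e) set) module" where
  "Ext_module R i N M =
     (let (b, d, aug) = (SOME (b, d, aug). free_resolution R N b d aug)
      in hom_cohomology R b d M i)"

text \<open>A module killed by \<open>m\<close>, regarded as a vector space over \<open>R/m\<close>: all representatives of a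
  coset act in the same way.\<close>

definition residue_space :: "('a, 'b, 'd) module_scheme \<Rightarrow> ('a set, 'b) module" where
  "residue_space V = \<lparr>carrier = carrier V, monoid.mult = undefined, one = undefined,
     zero = \<zero>\<^bsub>V\<^esub>, add = add V, smult = (\<lambda>c v. the_elem ((\<lambda>r. r \<odot>\<^bsub>V\<^esub> v) ` c))\<rparr>"

definition module_type ::
  "('a, 'c) ring_scheme \<Rightarrow> 'a set \<Rightarrow> ('a, 'b, 'd) module_scheme \<Rightarrow> nat" where
  "module_type R m M = vectorspace.dim (R Quot m)
     (residue_space (Ext_module R (the_enat (module_dim R M)) (quot_ring_module R m) M))"

definition ulrich_ideal :: "('a, 'c) ring_scheme \<Rightarrow> 'a set \<Rightarrow> 'a set \<Rightarrow> bool" where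
  "ulrich_ideal R m I \<longleftrightarrow> ideal_primary_to R m I \<and> real (ideal_mu R I) = hs_multiplicity R m"

definition elias_ideal :: "('a, 'c) ring_scheme \<Rightarrow> 'a set \<Rightarrow> 'a set \<Rightarrow> bool" where
  "elias_ideal R m I \<longleftrightarrow> ideal_primary_to R m I \<and>
     module_type R m (ideal_module R I) = module_type R m (quot_ring_module R I)"

definition burch_ideal :: "('a, 'c) ring_scheme \<Rightarrow> 'a set \<Rightarrow> 'a set \<Rightarrow> bool" where
  "burch_ideal R m I \<longleftrightarrow> ideal I R \<and> ideal_prod R m I \<noteq> ideal_prod R m (ideal_colon R I m)"

end

theory Submission
  imports Defs
begin

text \<open>
Let \<open>z \<in> m\<close> be a regular element that generates a reduction of \<open>m\<close>, that is, \<open>m\<^sup>r\<^sup>+\<^sup>1 = z m\<^sup>r\<close> for some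
\<open>r\<close>. Then the length of \<open>R/m\<^sup>n\<close> eventually grows by \<open>length (R/zR)\<close> in each step, so that the
multiplicity is \<open>e(R) = length (R/zR)\<close>. For every \<open>m\<close>-primary ideal \<open>I\<close> also \<open>length (I/zI) = e(R)\<close>,
by additivity of length. Since \<open>zI \<subseteq> mI\<close> and \<open>length (I/mI) \<ge> \<mu>(I)\<close>, an Ulrich ideal satisfies
\<open>zI = mI\<close> (\<open>ulrich_ideal_multiple\<close>). If moreover \<open>mI = m(I : m)\<close>, then \<open>z(I : m) \<subseteq> zI\<close>, and cancelling
\<open>z\<close> gives \<open>I : m \<subseteq> I\<close>; but \<open>R/I\<close> has a nonzero socle. So \<open>I\<close> is Burch (\<open>burch_ideal_if_multiple\<close>).

The work lies in finding \<open>z\<close>. Cohen-Macaulayness provides a regular element \<open>x \<in> m\<close>, and in dimension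
one \<open>m\<close> is the only prime containing it. Hence \<open>R/xR\<close> has finite length \<open>n\<close>, and \<open>n\<close> bounds
\<open>length (N/mN)\<close> for every ideal \<open>N\<close> of finite colength. This bound, with an infinite residue field,
yields a one-element reduction of any \<open>(x, y)\<close> by an argument in the style of Eakin and Sathaye, made
explicit with products of the elements \<open>x + u y\<close> (\<open>exists_reduction_of_two_generated\<close>). Absorbing
the generators of \<open>m\<close> one after another gives \<open>z\<close>.

Lengths are measured by chains of ideals of \<open>R\<close> between two given ideals. Additivity then only uses
the modular law, and no quotient modules occur until the definition of the multiplicity.
\<close>

text \<open>In this text \<open><+>\<close> always denotes the sum of ideals.\<close>

no_notation Sum_Type.Plus (infixr \<open><+>\<close> 65)

section \<open>The length of a pair of ideals\<close>

definition ideal_chain :: "('a, 'c) ring_scheme \<Rightarrow> 'a set \<Rightarrow> 'a set \<Rightarrow> nat \<Rightarrow> (nat \<Rightarrow> 'a set) \<Rightarrow> bool" where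
  "ideal_chain R A B n N \<longleftrightarrow>
     (\<forall>i\<le>n. ideal (N i) R \<and> A \<subseteq> N i \<and> N i \<subseteq> B) \<and> (\<forall>i<n. N i \<subset> N (Suc i))"

text \<open>For ideals \<open>A \<subseteq> B\<close> this is the length of the module \<open>B/A\<close>. Working with chains of ideals of
\<open>R\<close> instead of quotient modules keeps every length inside the one lattice of ideals.\<close>

definition ideal_length :: "('a, 'c) ring_scheme \<Rightarrow> 'a set \<Rightarrow> 'a set \<Rightarrow> enat" where
  "ideal_length R A B = (SUP n \<in> {n. \<exists>N. ideal_chain R A B n N}. enat n)"

lemma ideal_length_upper: "ideal_chain R A B n N \<Longrightarrow> enat n \<le> ideal_length R A B"
  unfolding ideal_length_def by (rule SUP_upper) blast

lemma ideal_length_least: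
  "(\<And>n N. ideal_chain R A B n N \<Longrightarrow> enat n \<le> c) \<Longrightarrow> ideal_length R A B \<le> c"
  unfolding ideal_length_def by (rule SUP_least) blast

lemma ideal_length_mono:
  assumes "A' \<subseteq> A" "B \<subseteq> B'"
  shows "ideal_length R A B \<le> ideal_length R A' B'"
proof (rule ideal_length_least)
  fix n N assume "ideal_chain R A B n N"
  with assms have "ideal_chain R A' B' n N"
    unfolding ideal_chain_def by blast
  thus "enat n \<le> ideal_length R A' B'" by (rule ideal_length_upper)
qed

lemma ideal_length_attained:
  assumes "ideal A R" "A \<subseteq> B" "ideal_length R A B = enat n"
  shows "\<exists>N. ideal_chain R A B n N"
proof (rule ccontr)
  assume none: "\<not> ?thesis"
  have "ideal_chain R A B 0 (\<lambda>_. A)"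
    using assms by (simp add: ideal_chain_def)
  hence "n \<noteq> 0" using none by (cases "n = 0") auto
  have "ideal_length R A B \<le> enat (n - 1)"
  proof (rule ideal_length_least)
    fix k N assume *: "ideal_chain R A B k N"
    hence "k \<le> n" using ideal_length_upper assms(3) by fastforce
    moreover have "k \<noteq> n" using none * by blast
    ultimately show "enat k \<le> enat (n - 1)" by simp
  qed
  thus False using assms(3) \<open>n \<noteq> 0\<close> by simp
qed

text \<open>Deleting the repetitions of a weakly increasing chain leaves a strict one; images of a strict chain
under intersection with, or addition of, a fixed ideal are only weakly increasing.\<close>

lemma weak_ideal_chain_length:
  assumes "\<And>i. i \<le> n \<Longrightarrow> ideal (N i) R \<and> A \<subseteq> N i \<and> N i \<subseteq> B"
    and "\<And>i. i < n \<Longrightarrow> N i \<subseteq> N (Suc i)"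
  shows "enat (card {i. i < n \<and> N i \<noteq> N (Suc i)}) \<le> ideal_length R A B"
proof -
  have "\<exists>N'. ideal_chain R A B (card {i. i < n \<and> N i \<noteq> N (Suc i)}) N'
          \<and> N' (card {i. i < n \<and> N i \<noteq> N (Suc i)}) = N n"
    using assms
  proof (induction n)
    case 0
    show ?case by (rule exI[of _ "\<lambda>_. N 0"]) (use 0 in \<open>simp add: ideal_chain_def\<close>)
  next
    case (Suc n)
    let ?k = "card {i. i < n \<and> N i \<noteq> N (Suc i)}"
    have "\<exists>N'. ideal_chain R A B ?k N' \<and> N' ?k = N n"
      using Suc.prems by (intro Suc.IH) auto
    then obtain N' where N': "ideal_chain R A B ?k N'" "N' ?k = N n" by blast
    show ?case
    proof (cases "N n = N (Suc n)")
      case True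
      hence "{i. i < Suc n \<and> N i \<noteq> N (Suc i)} = {i. i < n \<and> N i \<noteq> N (Suc i)}"
        using less_Suc_eq by auto
      thus ?thesis using N' True by auto
    next
      case False
      hence "{i. i < Suc n \<and> N i \<noteq> N (Suc i)} = insert n {i. i < n \<and> N i \<noteq> N (Suc i)}"
        using less_Suc_eq by auto
      hence k: "card {i. i < Suc n \<and> N i \<noteq> N (Suc i)} = Suc ?k" by simp
      have "N n \<subset> N (Suc n)" using False Suc.prems(2)[of n] by auto
      hence "ideal_chain R A B (Suc ?k) (N'(Suc ?k := N (Suc n)))"
        using N' Suc.prems(1)[of "Suc n"]
        unfolding ideal_chain_def by (simp add: less_Suc_eq le_Suc_eq)
      moreover have "(N'(Suc ?k := N (Suc n))) (Suc ?k) = N (Suc n)" by simp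
      ultimately show ?thesis unfolding k by blast
    qed
  qed
  thus ?thesis using ideal_length_upper by blast
qed

lemma (in ring) add_ideals_least:
  assumes "ideal C R" "A \<subseteq> C" "B \<subseteq> C"
  shows "A <+> B \<subseteq> C"
proof
  fix s assume "s \<in> A <+> B"
  then obtain a b where "a \<in> A" "b \<in> B" "s = a \<oplus> b" unfolding set_add_def' by blast
  thus "s \<in> C" using assms additive_subgroup.a_closed[OF ideal.axioms(1)[OF assms(1)]] by blast
qed

lemma (in ring) add_ideals_upper:
  assumes "ideal A R" "ideal B R"
  shows "A \<subseteq> A <+> B" "B \<subseteq> A <+> B"
proof -
  have "A \<union> B \<subseteq> carrier R"
    using assms by (simp add: additive_subgroup.a_subset ideal.axioms(1))
  hence "A \<union> B \<subseteq> A <+> B"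
    using union_genideal[OF assms] genideal_self by metis
  thus "A \<subseteq> A <+> B" "B \<subseteq> A <+> B" by auto
qed

text \<open>The modular law: an inclusion of ideals that becomes an equality both below and above a third ideal
was an equality.\<close>

lemma (in ring) ideal_modular_cancel:
  assumes "ideal N R" "ideal N' R" "ideal B R" "N \<subseteq> N'"
    and "N \<inter> B = N' \<inter> B" "N <+> B = N' <+> B"
  shows "N = N'"
proof
  show "N' \<subseteq> N"
  proof
    fix a assume a: "a \<in> N'"
    hence "a \<in> N <+> B" using add_ideals_upper(1)[of N' B] assms by blast
    then obtain c b where cb: "c \<in> N" "b \<in> B" "a = c \<oplus> b"
      unfolding set_add_def' by blast
    interpret N: ideal N R by fact
    interpret N': ideal N' R by fact
    interpret B: ideal B R by fact
    have carr: "c \<in> carrier R" "b \<in> carrier R" using cb by auto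
    have "\<ominus> c \<oplus> a \<in> N'" using a cb assms(4) by blast
    hence "b \<in> N'" using cb carr by (simp add: r_neg1)
    hence "b \<in> N" using cb assms(5) by blast
    thus "a \<in> N" using cb by blast
  qed
qed fact

text \<open>Cut a chain at \<open>B\<close> by sending \<open>N\<close> to \<open>N \<inter> B\<close> and to \<open>N + B\<close>. By the modular law each strict
step of the chain survives in at least one of the two images.\<close>

lemma (in ring) ideal_length_add_le:
  assumes "ideal A R" "ideal B R" "ideal C R" "A \<subseteq> B" "B \<subseteq> C"
  shows "ideal_length R A C \<le> ideal_length R A B + ideal_length R B C"
proof (rule ideal_length_least)
  fix n N assume chain: "ideal_chain R A C n N"
  hence N: "\<And>i. i \<le> n \<Longrightarrow> ideal (N i) R \<and> A \<subseteq> N i \<and> N i \<subseteq> C"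
    and strict: "\<And>i. i < n \<Longrightarrow> N i \<subset> N (Suc i)"
    unfolding ideal_chain_def by auto
  let ?X = "{i. i < n \<and> N i \<inter> B \<noteq> N (Suc i) \<inter> B}"
  let ?Y = "{i. i < n \<and> N i <+> B \<noteq> N (Suc i) <+> B}"
  have X: "enat (card ?X) \<le> ideal_length R A B"
  proof (rule weak_ideal_chain_length)
    fix i assume "i \<le> n"
    thus "ideal (N i \<inter> B) R \<and> A \<subseteq> N i \<inter> B \<and> N i \<inter> B \<subseteq> B"
      using N[of i] assms i_intersect by auto
  next
    fix i assume "i < n"
    thus "N i \<inter> B \<subseteq> N (Suc i) \<inter> B" using strict[of i] by blast
  qed
  have Y: "enat (card ?Y) \<le> ideal_length R B C"
  proof (rule weak_ideal_chain_length)
    fix i assume "i \<le> n"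
    thus "ideal (N i <+> B) R \<and> B \<subseteq> N i <+> B \<and> N i <+> B \<subseteq> C"
      using N[of i] assms add_ideals add_ideals_upper add_ideals_least by metis
  next
    fix i assume "i < n"
    thus "N i <+> B \<subseteq> N (Suc i) <+> B"
      using strict[of i] unfolding set_add_def' by blast
  qed
  have "{..<n} \<subseteq> ?X \<union> ?Y"
  proof
    fix i assume "i \<in> {..<n}"
    hence i: "i < n" by simp
    with ideal_modular_cancel[of "N i" "N (Suc i)" B] N[of i] N[of "Suc i"] strict[of i] assms
    show "i \<in> ?X \<union> ?Y" by auto
  qed
  hence "card {..<n} \<le> card (?X \<union> ?Y)" by (intro card_mono) auto
  hence "n \<le> card ?X + card ?Y" using card_Un_le[of ?X ?Y] by simp
  hence "enat n \<le> enat (card ?X) + enat (card ?Y)" by simp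
  also have "\<dots> \<le> ideal_length R A B + ideal_length R B C"
    using X Y by (rule add_mono)
  finally show "enat n \<le> ideal_length R A B + ideal_length R B C" .
qed

lemma ideal_chain_append:
  assumes "ideal_chain R A B n N" "ideal_chain R B C k M" "A \<subseteq> B" "B \<subseteq> C"
  shows "ideal_chain R A C (n + k) (\<lambda>i. if i \<le> n then N i else M (i - n))"
proof -
  have N: "\<And>i. i \<le> n \<Longrightarrow> ideal (N i) R \<and> A \<subseteq> N i \<and> N i \<subseteq> B"
    and N_strict: "\<And>i. i < n \<Longrightarrow> N i \<subset> N (Suc i)"
    and M: "\<And>i. i \<le> k \<Longrightarrow> ideal (M i) R \<and> B \<subseteq> M i \<and> M i \<subseteq> C"
    and M_strict: "\<And>i. i < k \<Longrightarrow> M i \<subset> M (Suc i)"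
    using assms unfolding ideal_chain_def by auto
  have mid: "N n \<subset> M (Suc 0)" if "0 < k"
    using N[of n] M[of 0] M_strict[of 0] that by auto
  show ?thesis
    unfolding ideal_chain_def
  proof (intro conjI allI impI)
    fix i assume i: "i \<le> n + k"
    hence "i - n \<le> k" by simp
    with N[of i] M[of "i - n"] assms(3,4)
    show "ideal (if i \<le> n then N i else M (i - n)) R"
      "A \<subseteq> (if i \<le> n then N i else M (i - n))"
      "(if i \<le> n then N i else M (i - n)) \<subseteq> C"
      by auto
  next
    fix i assume i: "i < n + k"
    consider "i < n" | "i = n" | "n < i" by linarith
    thus "(if i \<le> n then N i else M (i - n)) \<subset> (if Suc i \<le> n then N (Suc i) else M (Suc i - n))"
    proof cases
      case 1 thus ?thesis using N_strict[of i] by simp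
    next
      case 2 thus ?thesis using mid i by simp
    next
      case 3
      have "Suc i - n = Suc (i - n)" using 3 by simp
      thus ?thesis using M_strict[of "i - n"] i 3 by simp
    qed
  qed
qed

text \<open>This additivity replaces the Jordan-Hoelder theorem. The bound from below appends chains; it needs
chains of maximal length, which exist when \<open>ideal_length R A C\<close> is finite; in the infinite case
that bound is trivial.\<close>

theorem (in ring) ideal_length_add:
  assumes "ideal A R" "ideal B R" "ideal C R" "A \<subseteq> B" "B \<subseteq> C"
  shows "ideal_length R A C = ideal_length R A B + ideal_length R B C"
proof (rule antisym)
  show "ideal_length R A B + ideal_length R B C \<le> ideal_length R A C"
  proof (cases "ideal_length R A C")
    case (enat l)
    have "ideal_length R A B \<le> enat l" "ideal_length R B C \<le> enat l"
      using ideal_length_mono[of A A B C R] ideal_length_mono[of A B C C R] assms enat by auto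
    then obtain n k where n: "ideal_length R A B = enat n" and k: "ideal_length R B C = enat k"
      by (metis enat_ile)
    obtain N M where "ideal_chain R A B n N" "ideal_chain R B C k M"
      using ideal_length_attained[of A R B n] ideal_length_attained[of B R C k] assms n k by blast
    from ideal_length_upper[OF ideal_chain_append[OF this assms(4,5)]] show ?thesis
      using n k by simp
  qed simp
qed (rule ideal_length_add_le[OF assms])

lemma ideal_length_pos:
  assumes "ideal A R" "ideal B R" "A \<subset> B"
  shows "1 \<le> ideal_length R A B"
proof -
  have "ideal_chain R A B 1 (\<lambda>i. if i = 0 then A else B)"
    using assms unfolding ideal_chain_def by auto
  from ideal_length_upper[OF this] show ?thesis by (simp add: one_enat_def)
qed

lemma (in cring) mem_PIdl_prod_iff:
  assumes "x \<in> carrier R" "ideal A R"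
  shows "s \<in> (PIdl x) \<cdot> A \<longleftrightarrow> (\<exists>a\<in>A. s = x \<otimes> a)"
proof
  interpret A: ideal A R by fact
  assume "s \<in> (PIdl x) \<cdot> A"
  thus "\<exists>a\<in>A. s = x \<otimes> a"
  proof induct
    case (prod i j)
    then obtain r where "r \<in> carrier R" "i = r \<otimes> x" unfolding cgenideal_def by blast
    with prod assms show ?case
      by (intro bexI[of _ "r \<otimes> j"]) (auto simp: m_ac A.I_l_closed A.I_r_closed A.Icarr)
  next
    case (sum s1 s2)
    then obtain a b where "a \<in> A" "b \<in> A" "s1 = x \<otimes> a" "s2 = x \<otimes> b" by blast
    with assms show ?case
      by (intro bexI[of _ "a \<oplus> b"]) (auto simp: r_distr A.Icarr)
  qed
next
  assume "\<exists>a\<in>A. s = x \<otimes> a"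
  thus "s \<in> (PIdl x) \<cdot> A" using cgenideal_self assms ideal_prod.prod by metis
qed

lemma (in cring) ideal_colon_ideal:
  assumes A: "ideal A R" and J: "J \<subseteq> carrier R"
  shows "ideal (ideal_colon R A J) R"
proof -
  interpret A: ideal A R by fact
  show ?thesis
  proof (rule idealI[OF ring_axioms])
    show "subgroup (ideal_colon R A J) (add_monoid R)"
    proof (rule add.subgroupI)
      have "\<zero> \<in> ideal_colon R A J" using J by (auto simp: ideal_colon_def)
      thus "ideal_colon R A J \<noteq> {}" by blast
    qed (use J in \<open>auto simp: ideal_colon_def l_distr l_minus subset_iff\<close>)
  next
    fix a r assume a: "a \<in> ideal_colon R A J" "r \<in> carrier R"
    thus "r \<otimes> a \<in> ideal_colon R A J"
      using J by (auto simp: ideal_colon_def m_assoc subset_iff A.I_l_closed)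
    thus "a \<otimes> r \<in> ideal_colon R A J"
      using a by (simp add: m_comm ideal_colon_def)
  qed
qed

definition (in ring) regular_element :: "'a \<Rightarrow> bool" where
  "regular_element x \<longleftrightarrow> x \<in> carrier R \<and> (\<forall>r\<in>carrier R. x \<otimes> r = \<zero> \<longrightarrow> r = \<zero>)"

lemma (in ring) regular_element_cancel:
  assumes "regular_element x" "a \<in> carrier R" "b \<in> carrier R" "x \<otimes> a = x \<otimes> b"
  shows "a = b"
proof -
  have x: "x \<in> carrier R" using assms by (simp add: regular_element_def)
  have "x \<otimes> (a \<ominus> b) = \<zero>" using assms x by (simp add: a_minus_def r_distr r_minus r_neg)
  hence "a \<ominus> b = \<zero>" using assms by (simp add: regular_element_def)
  thus ?thesis using assms by simp
qed

lemma (in cring) ideal_prod_mono: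
  assumes "A \<subseteq> A'" "B \<subseteq> B'"
  shows "A \<cdot> B \<subseteq> A' \<cdot> B'"
proof
  fix s assume "s \<in> A \<cdot> B"
  thus "s \<in> A' \<cdot> B'"
    by induct (use assms in \<open>auto intro: ideal_prod.intros\<close>)
qed

text \<open>Multiplication by a regular element is an isomorphism from the lattice of ideals between \<open>A\<close> and
\<open>B\<close> to the one between \<open>xA\<close> and \<open>xB\<close>; the inverse sends \<open>N\<close> to \<open>N : x\<close>.\<close>

lemma (in cring) ideal_length_PIdl_prod:
  assumes x: "regular_element x" and A: "ideal A R" and B: "ideal B R"
  shows "ideal_length R ((PIdl x) \<cdot> A) ((PIdl x) \<cdot> B) = ideal_length R A B"
proof (rule antisym)
  have xc: "x \<in> carrier R" using x by (simp add: regular_element_def)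
  interpret A: ideal A R by fact
  interpret B: ideal B R by fact
  show "ideal_length R A B \<le> ideal_length R ((PIdl x) \<cdot> A) ((PIdl x) \<cdot> B)"
  proof (rule ideal_length_least)
    fix n N assume chain: "ideal_chain R A B n N"
    have "(PIdl x) \<cdot> N i \<subset> (PIdl x) \<cdot> N (Suc i)" if i: "i < n" for i
    proof -
      have id: "ideal (N i) R" "ideal (N (Suc i)) R" and "N i \<subset> N (Suc i)"
        using chain i unfolding ideal_chain_def by auto
      then obtain a where a: "a \<in> N (Suc i)" "a \<notin> N i" by blast
      hence "x \<otimes> a \<in> (PIdl x) \<cdot> N (Suc i)" using mem_PIdl_prod_iff[OF xc id(2)] by blast
      moreover have "x \<otimes> a \<notin> (PIdl x) \<cdot> N i"
        using mem_PIdl_prod_iff[OF xc id(1)] regular_element_cancel[OF x] a id ideal.Icarr by metis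
      moreover have "(PIdl x) \<cdot> N i \<subseteq> (PIdl x) \<cdot> N (Suc i)"
        using \<open>N i \<subset> N (Suc i)\<close> by (intro ideal_prod_mono) auto
      ultimately show ?thesis by blast
    qed
    hence "ideal_chain R ((PIdl x) \<cdot> A) ((PIdl x) \<cdot> B) n (\<lambda>i. (PIdl x) \<cdot> N i)"
      using chain ideal_prod_mono[OF order_refl, of _ _ "PIdl x"]
        ideal_prod_is_ideal[OF cgenideal_ideal[OF xc]]
      unfolding ideal_chain_def by simp
    thus "enat n \<le> ideal_length R ((PIdl x) \<cdot> A) ((PIdl x) \<cdot> B)" by (rule ideal_length_upper)
  qed
  show "ideal_length R ((PIdl x) \<cdot> A) ((PIdl x) \<cdot> B) \<le> ideal_length R A B"
  proof (rule ideal_length_least)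
    fix n N assume chain: "ideal_chain R ((PIdl x) \<cdot> A) ((PIdl x) \<cdot> B) n N"
    define M where "M i = ideal_colon R (N i) {x}" for i
    have mem_M: "r \<in> M i \<longleftrightarrow> r \<in> carrier R \<and> x \<otimes> r \<in> N i" for r i
      unfolding M_def ideal_colon_def using xc by (auto simp: m_comm)
    have M: "ideal (M i) R \<and> A \<subseteq> M i \<and> M i \<subseteq> B \<and> (PIdl x) \<cdot> M i = N i" if i: "i \<le> n" for i
    proof -
      have N: "ideal (N i) R" "(PIdl x) \<cdot> A \<subseteq> N i" "N i \<subseteq> (PIdl x) \<cdot> B"
        using chain i unfolding ideal_chain_def by auto
      interpret N: ideal "N i" R by fact
      have id: "ideal (M i) R" unfolding M_def using N(1) xc by (intro ideal_colon_ideal) auto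
      moreover have "A \<subseteq> M i"
        proof
        fix a assume a: "a \<in> A"
        hence "x \<otimes> a \<in> (PIdl x) \<cdot> A" using mem_PIdl_prod_iff[OF xc A] by blast
        thus "a \<in> M i" using N(2) a by (auto simp: mem_M)
      qed
      moreover have MB: "M i \<subseteq> B"
      proof
        fix r assume r: "r \<in> M i"
        then obtain b where "b \<in> B" "x \<otimes> r = x \<otimes> b"
          using N(3) mem_PIdl_prod_iff[OF xc B] by (auto simp: mem_M)
        thus "r \<in> B" using regular_element_cancel[OF x, of r b] r by (auto simp: mem_M B.Icarr)
      qed
      moreover have "(PIdl x) \<cdot> M i = N i"
      proof
        show "(PIdl x) \<cdot> M i \<subseteq> N i"
        proof
          fix s assume "s \<in> (PIdl x) \<cdot> M i"
          then obtain b where "b \<in> M i" "s = x \<otimes> b"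
            using mem_PIdl_prod_iff[OF xc id] by blast
          thus "s \<in> N i" by (simp add: mem_M)
        qed
        show "N i \<subseteq> (PIdl x) \<cdot> M i"
        proof
          fix s assume s: "s \<in> N i"
          then obtain b where b: "b \<in> B" "s = x \<otimes> b"
            using N(3) mem_PIdl_prod_iff[OF xc B] by blast
          hence "b \<in> M i" using s by (simp add: mem_M B.Icarr)
          thus "s \<in> (PIdl x) \<cdot> M i" using b mem_PIdl_prod_iff[OF xc id] by blast
        qed
      qed
      ultimately show ?thesis by blast
    qed
    have "M i \<subset> M (Suc i)" if i: "i < n" for i
    proof -
      have strict: "N i \<subset> N (Suc i)" using chain i unfolding ideal_chain_def by auto
      hence "M i \<subseteq> M (Suc i)" by (auto simp: mem_M)
      moreover have "M i \<noteq> M (Suc i)" using M[of i] M[of "Suc i"] i strict by auto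
      ultimately show ?thesis by blast
    qed
    moreover have "\<forall>i\<le>n. ideal (M i) R \<and> A \<subseteq> M i \<and> M i \<subseteq> B" using M by blast
    ultimately have "ideal_chain R A B n M" unfolding ideal_chain_def by blast
    thus "enat n \<le> ideal_length R A B" by (rule ideal_length_upper)
  qed
qed

text \<open>Adding the elements \<open>g j\<close> to \<open>A\<close> one after another gives a strict chain. The family is indexed
because it is applied to products, which need not be distinct beforehand.\<close>

lemma (in ring) ideal_length_irredundant:
  assumes "finite U" "ideal A R" "ideal B R" "A \<subseteq> B" "g ` U \<subseteq> B"
    and "\<And>j. j \<in> U \<Longrightarrow> g j \<notin> Idl (A \<union> g ` (U - {j}))"
  shows "enat (card U) \<le> ideal_length R A B"
  using assms
proof (induction U arbitrary: B)
  case empty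
  thus ?case by (simp flip: zero_enat_def)
next
  case (insert j U)
  have B: "B \<subseteq> carrier R" using insert.prems by (simp add: additive_subgroup.a_subset ideal.axioms(1))
  define B' where "B' = Idl (A \<union> g ` U)"
  have gen: "A \<union> g ` U \<subseteq> carrier R" using insert.prems B by auto
  have B': "ideal B' R" unfolding B'_def by (rule genideal_ideal[OF gen])
  have sub: "A \<union> g ` U \<subseteq> B'" unfolding B'_def by (rule genideal_self[OF gen])
  have B'B: "B' \<subseteq> B" unfolding B'_def using insert.prems by (intro genideal_minimal) auto
  have "enat (card U) \<le> ideal_length R A B'"
  proof (rule insert.IH)
    fix i assume i: "i \<in> U"
    have "g i \<notin> Idl (A \<union> g ` (insert j U - {i}))" using insert.prems(5) i by blast
    moreover have "Idl (A \<union> g ` (U - {i})) \<subseteq> Idl (A \<union> g ` (insert j U - {i}))"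
      using insert.prems B by (intro subset_Idl_subset) auto
    ultimately show "g i \<notin> Idl (A \<union> g ` (U - {i}))" by blast
  qed (use insert.prems B' sub in auto)
  moreover have "g j \<notin> B'"
    using insert.prems(5)[of j] insert.hyps unfolding B'_def by simp
  hence "B' \<subset> B" using B'B insert.prems by auto
  hence "1 \<le> ideal_length R B' B" by (intro ideal_length_pos B' insert.prems)
  ultimately have "enat (card U) + 1 \<le> ideal_length R A B' + ideal_length R B' B"
    by (rule add_mono)
  also have "\<dots> = ideal_length R A B"
    using insert.prems B' sub B'B by (intro ideal_length_add[symmetric]) auto
  finally show ?case using insert.hyps by (simp add: one_enat_def)
qed

text \<open>Both \<open>N/xN\<close> and \<open>R/xR\<close> complete a copy of \<open>R/N\<close> to \<open>R/xN\<close>: one reads \<open>xN \<subseteq> N \<subseteq> R\<close> and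
\<open>xN \<subseteq> xR \<subseteq> R\<close>, where \<open>xR/xN\<close> is isomorphic to \<open>R/N\<close>. Finiteness of the length of \<open>R/N\<close> allows to
cancel it.\<close>

lemma (in cring) ideal_length_regular_multiple:
  assumes x: "regular_element x" and N: "ideal N R"
    and fin: "ideal_length R N (carrier R) \<noteq> \<infinity>"
  shows "ideal_length R ((PIdl x) \<cdot> N) N = ideal_length R (PIdl x) (carrier R)"
proof -
  have xc: "x \<in> carrier R" using x by (simp add: regular_element_def)
  have X: "ideal (PIdl x) R" by (rule cgenideal_ideal[OF xc])
  have Nc: "N \<subseteq> carrier R" using N by (simp add: additive_subgroup.a_subset ideal.axioms(1))
  have Xc: "PIdl x \<subseteq> carrier R" using X by (simp add: additive_subgroup.a_subset ideal.axioms(1))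
  have XN: "ideal ((PIdl x) \<cdot> N) R" by (rule ideal_prod_is_ideal[OF X N])
  have sub: "(PIdl x) \<cdot> N \<subseteq> N" "(PIdl x) \<cdot> N \<subseteq> PIdl x" using ideal_prod_inter[OF X N] by auto
  have "ideal_length R ((PIdl x) \<cdot> N) N + ideal_length R N (carrier R)
      = ideal_length R ((PIdl x) \<cdot> N) (carrier R)"
    by (rule ideal_length_add[symmetric]) (use XN N oneideal sub Nc in auto)
  also have "\<dots> = ideal_length R ((PIdl x) \<cdot> N) (PIdl x) + ideal_length R (PIdl x) (carrier R)"
    by (rule ideal_length_add) (use XN X oneideal sub Xc in auto)
  also have "ideal_length R ((PIdl x) \<cdot> N) (PIdl x) = ideal_length R N (carrier R)"
    using ideal_length_PIdl_prod[OF x N oneideal] ideal_prod_one[OF X] by simp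
  finally show ?thesis using fin by (cases "ideal_length R N (carrier R)")
    (auto simp: add.commute[of "enat _"] enat_add_left_cancel)
qed

text \<open>The submodules of \<open>R/A\<close> are the ideals of the quotient ring, and these correspond to the ideals of
\<open>R\<close> above \<open>A\<close>.\<close>

lemma (in cring) module_length_quot_ring_module:
  assumes A: "ideal A R"
  shows "module_length R (quot_ring_module R A) = ideal_length R A (carrier R)"
proof -
  interpret A: ideal A R by fact
  let ?Q = "quot_ring_module R A"
  have fields: "carrier ?Q = carrier (R Quot A)" "add ?Q = add (R Quot A)" "zero ?Q = zero (R Quot A)"
    by (simp_all add: quot_module_def ideal_module_def FactRing_def A_RCOSETS_defs set_add_defs
        r_coset_def fun_eq_iff)
  have subgroup_iff: "subgroup N (add_monoid ?Q) \<longleftrightarrow> subgroup N (add_monoid (R Quot A))" for N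
    by (simp add: subgroup_def m_inv_def fields)
  have coset: "\<exists>b\<in>carrier R. X = A +> b" if "X \<in> carrier (R Quot A)" for X
    using that unfolding FactRing_def A_RCOSETS_def' by auto
  have coset_eq: "A +> x = A +> b" if "x \<in> A +> b" "b \<in> carrier R" for x b
    using add.repr_independence[of x A b] that A.a_subgroup by (simp add: a_r_coset_def)
  have smult: "r \<odot>\<^bsub>?Q\<^esub> X = (A +> r) \<otimes>\<^bsub>R Quot A\<^esub> X"
    if r: "r \<in> carrier R" and X: "X \<in> carrier (R Quot A)" for r X
  proof -
    obtain b where b: "b \<in> carrier R" "X = A +> b" using coset[OF X] by blast
    have "A +> (r \<otimes> x) = A +> (r \<otimes> b)" if x: "x \<in> A +> b" for x
    proof (rule coset_eq)
      obtain a where a: "a \<in> A" "x = a \<oplus> b" using x unfolding a_r_coset_def' by blast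
      hence "r \<otimes> x = r \<otimes> a \<oplus> r \<otimes> b" using r b by (simp add: r_distr A.Icarr)
      moreover have "r \<otimes> a \<in> A" using r a by (intro A.I_l_closed)
      ultimately show "r \<otimes> x \<in> A +> (r \<otimes> b)" unfolding a_r_coset_def' by blast
    qed (use r b in simp)
    moreover have "b \<in> A +> b" using b(1) by (rule A.a_rcos_self)
    ultimately have "(\<Union>x\<in>A +> b. A +> (r \<otimes> x)) = A +> (r \<otimes> b)" by blast
    moreover have "r \<odot>\<^bsub>?Q\<^esub> X = (\<Union>x\<in>X. A +> (r \<otimes> x))"
      by (simp add: quot_module_def ideal_module_def a_r_coset_def r_coset_def)
    moreover have "(A +> r) \<otimes>\<^bsub>R Quot A\<^esub> (A +> b) = A +> (r \<otimes> b)"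
      using r b by (simp add: FactRing_def A.rcoset_mult_add)
    ultimately show ?thesis using b by simp
  qed
  interpret Q: cring "R Quot A" by (rule A.quotient_is_cring[OF is_cring])
  have submodule_iff: "Module.submodule N R ?Q \<longleftrightarrow> ideal N (R Quot A)" for N
  proof
    assume N: "Module.submodule N R ?Q"
    hence sub: "subgroup N (add_monoid (R Quot A))"
      unfolding Module.submodule_def subgroup_iff by blast
    have Nc: "N \<subseteq> carrier (R Quot A)" using subgroup.subset[OF sub] by simp
    show "ideal N (R Quot A)"
    proof (rule idealI[OF Q.ring_axioms sub])
      fix X Y assume XY: "X \<in> N" "Y \<in> carrier (R Quot A)"
      obtain r where r: "r \<in> carrier R" "Y = A +> r" using coset[OF XY(2)] by blast
      have "r \<odot>\<^bsub>?Q\<^esub> X \<in> N" using Module.submodule.smult_closed[OF N r(1) XY(1)] .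
      thus "Y \<otimes>\<^bsub>R Quot A\<^esub> X \<in> N" using smult[OF r(1)] r(2) XY(1) Nc by auto
      thus "X \<otimes>\<^bsub>R Quot A\<^esub> Y \<in> N" using Q.m_comm[of X Y] XY Nc by auto
    qed
  next
    assume N: "ideal N (R Quot A)"
    then interpret N: ideal N "R Quot A" .
    have "subgroup N (add_monoid ?Q)" unfolding subgroup_iff by (rule N.a_subgroup)
    moreover have "r \<odot>\<^bsub>?Q\<^esub> X \<in> N" if "r \<in> carrier R" "X \<in> N" for r X
      using smult[OF that(1) N.Icarr[OF that(2)]] that(1)
        N.I_l_closed[OF that(2) ring_hom_closed[OF A.rcos_ring_hom that(1)]] by simp
    ultimately show "Module.submodule N R ?Q"
      by (intro Module.submodule.intro Module.submodule_axioms.intro)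
  qed
  have mem_Union: "a \<in> \<Union>N \<longleftrightarrow> A +> a \<in> N" if "ideal N (R Quot A)" "a \<in> carrier R" for N a
    using canonical_proj_vimage_mem_iff[OF A _ that(2)] that(1)
    by (simp add: additive_subgroup.a_subset ideal.axioms(1))
  have "(\<exists>N. (\<forall>i\<le>n. Module.submodule (N i) R ?Q) \<and> (\<forall>i<n. N i \<subset> N (Suc i)))
      \<longleftrightarrow> (\<exists>N. ideal_chain R A (carrier R) n N)" for n
  proof
    assume "\<exists>N. (\<forall>i\<le>n. Module.submodule (N i) R ?Q) \<and> (\<forall>i<n. N i \<subset> N (Suc i))"
    then obtain N where N: "\<And>i. i \<le> n \<Longrightarrow> ideal (N i) (R Quot A)"
      and strict: "\<And>i. i < n \<Longrightarrow> N i \<subset> N (Suc i)"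
      unfolding submodule_iff by blast
    have "ideal (\<Union>(N i)) R \<and> A \<subseteq> \<Union>(N i) \<and> \<Union>(N i) \<subseteq> carrier R" if i: "i \<le> n" for i
    proof -
      have "\<zero>\<^bsub>R Quot A\<^esub> \<in> N i"
        using N[OF i] by (simp add: additive_subgroup.zero_closed ideal.axioms(1))
      hence "A \<subseteq> \<Union>(N i)" by (auto simp: FactRing_def)
      moreover have "ideal (\<Union>(N i)) R" by (rule quot_ideal_imp_ring_ideal[OF A N[OF i]])
      ultimately show ?thesis by (simp add: additive_subgroup.a_subset ideal.axioms(1))
    qed
    moreover have "\<Union>(N i) \<subset> \<Union>(N (Suc i))" if i: "i < n" for i
    proof -
      obtain X where X: "X \<in> N (Suc i)" "X \<notin> N i" using strict[OF i] by blast
      then obtain b where "b \<in> carrier R" "X = A +> b"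
        using coset ideal.Icarr[OF N[of "Suc i"]] i by (metis Suc_leI)
      hence "b \<in> \<Union>(N (Suc i))" "b \<notin> \<Union>(N i)"
        using X mem_Union[OF N] i by auto
      thus ?thesis using strict[OF i] by blast
    qed
    ultimately have "ideal_chain R A (carrier R) n (\<lambda>i. \<Union>(N i))"
      unfolding ideal_chain_def by simp
    thus "\<exists>N. ideal_chain R A (carrier R) n N" by blast
  next
    assume "\<exists>N. ideal_chain R A (carrier R) n N"
    then obtain N where N: "\<And>i. i \<le> n \<Longrightarrow> ideal (N i) R \<and> A \<subseteq> N i"
      and strict: "\<And>i. i < n \<Longrightarrow> N i \<subset> N (Suc i)"
      unfolding ideal_chain_def by blast
    note bij = quot_ideal_correspondence[OF A]
    have "ideal ((+>) A ` N i) (R Quot A)" if "i \<le> n" for i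
      using bij_betw_apply[OF bij, of "N i"] N[OF that] by simp
    moreover have "(+>) A ` N i \<subset> (+>) A ` N (Suc i)" if i: "i < n" for i
    proof -
      have "(+>) A ` N i \<noteq> (+>) A ` N (Suc i)"
        using inj_onD[OF bij_betw_imp_inj_on[OF bij], of "N i" "N (Suc i)"]
          N[of i] N[of "Suc i"] strict[OF i] i by auto
      thus ?thesis using strict[OF i] by blast
    qed
    ultimately show "\<exists>N. (\<forall>i\<le>n. Module.submodule (N i) R ?Q) \<and> (\<forall>i<n. N i \<subset> N (Suc i))"
      unfolding submodule_iff by (intro exI[of _ "\<lambda>i. (+>) A ` N i"]) simp
  qed
  thus ?thesis unfolding module_length_def ideal_length_def by simp
qed

section \<open>Noetherian local rings\<close>

locale noetherian_cring = cring R + noetherian_ring R for R (structure)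
begin

lemma exists_maximal_ideal_with:
  assumes "Q A" "\<And>I. Q I \<Longrightarrow> ideal I R"
  obtains M where "Q M" "\<And>I. Q I \<Longrightarrow> M \<subseteq> I \<Longrightarrow> I = M"
proof -
  have "\<exists>M\<in>Collect Q. \<forall>I\<in>Collect Q. M \<subseteq> I \<longrightarrow> I = M"
  proof (rule subset_Zorn_nonempty)
    show "Collect Q \<noteq> {}" using assms(1) by blast
  next
    fix D assume D: "D \<noteq> {}" "subset.chain (Collect Q) D"
    hence "subset.chain {I. ideal I R} D"
      using assms(2) unfolding subset.chain_def by (meson Collect_mono subset_trans)
    hence "\<Union>D \<in> D" by (rule ideal_chain_is_trivial[OF D(1)])
    moreover have "D \<subseteq> Collect Q" using D(2) unfolding subset.chain_def by simp
    ultimately show "\<Union>D \<in> Collect Q" by (rule rev_subsetD)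
  qed
  then obtain M where "Q M" "\<forall>I. Q I \<longrightarrow> M \<subseteq> I \<longrightarrow> I = M" by (auto simp only: Bex_def Ball_def mem_Collect_eq)
  thus thesis using that by simp
qed

text \<open>An ideal that is maximal among those containing \<open>A\<close> and disjoint from the multiplicative set \<open>S\<close> is
prime.\<close>

lemma exists_prime_avoiding:
  assumes A: "ideal A R" and S: "S \<subseteq> carrier R" "\<one> \<in> S" "\<And>s t. s \<in> S \<Longrightarrow> t \<in> S \<Longrightarrow> s \<otimes> t \<in> S"
    and disj: "A \<inter> S = {}"
  shows "\<exists>P. primeideal P R \<and> A \<subseteq> P \<and> P \<inter> S = {}"
proof -
  obtain P where P: "ideal P R \<and> A \<subseteq> P \<and> P \<inter> S = {}"
    and max: "\<And>I. ideal I R \<and> A \<subseteq> I \<and> I \<inter> S = {} \<Longrightarrow> P \<subseteq> I \<Longrightarrow> I = P"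
    by (rule exists_maximal_ideal_with[of "\<lambda>I. ideal I R \<and> A \<subseteq> I \<and> I \<inter> S = {}" A])
      (use A disj in auto)
  hence P: "ideal P R" "A \<subseteq> P" "P \<inter> S = {}" by auto
  interpret P: ideal P R by fact
  have enlarge: "\<exists>p\<in>P. \<exists>r\<in>carrier R. p \<oplus> r \<otimes> a \<in> S" if a: "a \<in> carrier R" "a \<notin> P" for a
  proof -
    have id: "ideal (P <+> PIdl a) R" using a P by (intro add_ideals cgenideal_ideal)
    have up: "P \<subseteq> P <+> PIdl a" "PIdl a \<subseteq> P <+> PIdl a"
      using add_ideals_upper[OF P(1) cgenideal_ideal[OF a(1)]] by auto
    have "P <+> PIdl a \<noteq> P" using up(2) cgenideal_self[OF a(1)] a(2) by blast
    hence "(P <+> PIdl a) \<inter> S \<noteq> {}" using max[of "P <+> PIdl a"] id up(1) P(2) by blast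
    thus ?thesis unfolding set_add_def' cgenideal_def by blast
  qed
  have "primeideal P R"
  proof (rule primeidealI[OF P(1) is_cring])
    show "carrier R \<noteq> P" using P(3) S(2) by blast
  next
    fix a b assume ab: "a \<in> carrier R" "b \<in> carrier R" "a \<otimes> b \<in> P"
    show "a \<in> P \<or> b \<in> P"
    proof (rule ccontr)
      assume "\<not> ?thesis"
      then obtain p r q u where pq: "p \<in> P" "q \<in> P" "r \<in> carrier R" "u \<in> carrier R"
        and st: "p \<oplus> r \<otimes> a \<in> S" "q \<oplus> u \<otimes> b \<in> S"
        using enlarge[of a] enlarge[of b] ab by blast
      have "(p \<oplus> r \<otimes> a) \<otimes> (q \<oplus> u \<otimes> b)
          = p \<otimes> (q \<oplus> u \<otimes> b) \<oplus> ((r \<otimes> a) \<otimes> q \<oplus> (r \<otimes> u) \<otimes> (a \<otimes> b))"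
        using pq ab P.Icarr by (simp add: l_distr r_distr m_ac a_ac)
      also have "\<dots> \<in> P"
      proof (intro P.a_closed)
        show "p \<otimes> (q \<oplus> u \<otimes> b) \<in> P" using pq ab P.Icarr by (intro P.I_r_closed) auto
        show "(r \<otimes> a) \<otimes> q \<in> P" using pq ab by (intro P.I_l_closed[OF pq(2)]) auto
        show "(r \<otimes> u) \<otimes> (a \<otimes> b) \<in> P" using pq by (intro P.I_l_closed[OF ab(3)]) auto
      qed
      finally show False using S(3)[OF st] P(3) by blast
    qed
  qed
  with P show ?thesis by blast
qed

text \<open>The existence of associated primes of \<open>R/A\<close>: a maximal element among the annihilators of its nonzero
elements is prime.\<close>

lemma exists_prime_colon:
  assumes A: "ideal A R" "A \<noteq> carrier R"
  shows "\<exists>b\<in>carrier R - A. primeideal (ideal_colon R A {b}) R"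
proof -
  interpret A: ideal A R by fact
  let ?Q = "\<lambda>I. \<exists>b\<in>carrier R - A. I = ideal_colon R A {b}"
  have "\<one> \<notin> A" using A A.one_imp_carrier by blast
  hence "?Q (ideal_colon R A {\<one>})" by blast
  then obtain P where P: "?Q P" and max: "\<And>I. ?Q I \<Longrightarrow> P \<subseteq> I \<Longrightarrow> I = P"
    by (rule exists_maximal_ideal_with) (use A ideal_colon_ideal in auto)
  then obtain b where b: "b \<in> carrier R" "b \<notin> A" and P_eq: "P = ideal_colon R A {b}" by blast
  have "primeideal (ideal_colon R A {b}) R"
  proof (rule primeidealI[OF _ is_cring])
    show "ideal (ideal_colon R A {b}) R" using A b by (intro ideal_colon_ideal) auto
    have "\<one> \<notin> ideal_colon R A {b}" using b by (simp add: ideal_colon_def)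
    thus "carrier R \<noteq> ideal_colon R A {b}" by blast
  next
    fix u v assume uv: "u \<in> carrier R" "v \<in> carrier R" "u \<otimes> v \<in> ideal_colon R A {b}"
    show "u \<in> ideal_colon R A {b} \<or> v \<in> ideal_colon R A {b}"
    proof (cases "v \<otimes> b \<in> A")
      case True
      thus ?thesis using uv by (simp add: ideal_colon_def)
    next
      case False
      have "ideal_colon R A {v \<otimes> b} = ideal_colon R A {b}"
        unfolding P_eq[symmetric]
      proof (rule max, unfold P_eq)
        show "\<exists>c\<in>carrier R - A. ideal_colon R A {v \<otimes> b} = ideal_colon R A {c}"
          using False uv b by auto
        show "ideal_colon R A {b} \<subseteq> ideal_colon R A {v \<otimes> b}"
        proof
          fix r assume "r \<in> ideal_colon R A {b}"
          hence r: "r \<in> carrier R" "r \<otimes> b \<in> A" by (auto simp: ideal_colon_def)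
          hence "v \<otimes> (r \<otimes> b) \<in> A" using uv A.I_l_closed[OF r(2)] by blast
          thus "r \<in> ideal_colon R A {v \<otimes> b}" using r uv b by (simp add: ideal_colon_def m_lcomm)
        qed
      qed
      moreover have "u \<in> ideal_colon R A {v \<otimes> b}"
        using uv b by (simp add: ideal_colon_def m_assoc)
      ultimately show ?thesis by blast
    qed
  qed
  with b show ?thesis by blast
qed

end

sublocale noetherian_local_ring \<subseteq> noetherian_cring R ..

context noetherian_local_ring
begin

lemma m_ideal: "ideal m R"
  using maximal by (simp add: maximalideal_def)

lemma m_subset: "m \<subseteq> carrier R"
  using m_ideal by (simp add: additive_subgroup.a_subset ideal.axioms(1))

lemma one_notin_m: "\<one> \<notin> m"
  using maximalideal.I_notcarr[OF maximal] ideal.one_imp_carrier[OF m_ideal] by blast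

lemma proper_ideal_subset_m:
  assumes A: "ideal A R" "A \<noteq> carrier R"
  shows "A \<subseteq> m"
proof -
  obtain M where M: "ideal M R \<and> A \<subseteq> M \<and> M \<noteq> carrier R"
    and max: "\<And>I. ideal I R \<and> A \<subseteq> I \<and> I \<noteq> carrier R \<Longrightarrow> M \<subseteq> I \<Longrightarrow> I = M"
    by (rule exists_maximal_ideal_with[of "\<lambda>I. ideal I R \<and> A \<subseteq> I \<and> I \<noteq> carrier R" A])
      (use A in auto)
  have "maximalideal M R"
  proof (rule maximalidealI)
    fix J assume "ideal J R" "M \<subseteq> J"
    thus "J = M \<or> J = carrier R" using M max[of J] by blast
  qed (use M in auto)
  thus ?thesis using unique_maximal M by blast
qed

lemma Units_if_notin_m:
  assumes a: "a \<in> carrier R" "a \<notin> m"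
  shows "a \<in> Units R"
proof -
  have "PIdl a = carrier R"
    using proper_ideal_subset_m[OF cgenideal_ideal[OF a(1)]] cgenideal_self[OF a(1)] a(2) by blast
  then obtain r where r: "r \<in> carrier R" "\<one> = r \<otimes> a" unfolding cgenideal_def by blast
  thus ?thesis using a by (auto simp: Units_def m_comm intro!: bexI[of _ r])
qed

lemma unit_multiple_mem:
  assumes A: "ideal A R" and a: "a \<in> carrier R" "a \<notin> m" and b: "b \<in> carrier R" "a \<otimes> b \<in> A"
  shows "b \<in> A"
proof -
  have u: "a \<in> Units R" by (rule Units_if_notin_m[OF a])
  have "inv a \<otimes> (a \<otimes> b) \<in> A" using ideal.I_l_closed[OF A b(2)] u by blast
  moreover have "inv a \<otimes> (a \<otimes> b) = b" using u a b by (simp flip: m_assoc)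
  ultimately show ?thesis by simp
qed

lemma one_minus_notin_m:
  assumes "a \<in> m"
  shows "\<one> \<ominus> a \<notin> m"
proof
  interpret m: ideal m R by (rule m_ideal)
  assume "\<one> \<ominus> a \<in> m"
  hence "(\<one> \<ominus> a) \<oplus> a \<in> m" using assms by blast
  moreover have "(\<one> \<ominus> a) \<oplus> a = \<one>"
    using assms m_subset by (simp add: a_minus_def a_assoc l_neg subset_iff)
  ultimately show False using one_notin_m by simp
qed

text \<open>If \<open>m\<close> is the only prime above \<open>A\<close>, then the associated prime of \<open>R/A\<close> has to be \<open>m\<close>, so that \<open>R/A\<close>
has a nonzero socle.\<close>

lemma socle_element:
  assumes A: "ideal A R" "A \<noteq> carrier R"
    and prime: "\<And>P. primeideal P R \<Longrightarrow> A \<subseteq> P \<Longrightarrow> P = m"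
  shows "\<exists>b\<in>carrier R - A. \<forall>r\<in>m. r \<otimes> b \<in> A"
proof -
  obtain b where b: "b \<in> carrier R - A" "primeideal (ideal_colon R A {b}) R"
    using exists_prime_colon[OF A] by blast
  have "A \<subseteq> ideal_colon R A {b}"
    using b ideal.I_r_closed[OF A(1)] ideal.Icarr[OF A(1)] by (auto simp: ideal_colon_def)
  hence "ideal_colon R A {b} = m" using prime b by blast
  thus ?thesis using b by (auto simp: ideal_colon_def)
qed

lemma ideal_length_socle_le:
  assumes A: "ideal A R" and b: "b \<in> carrier R" "\<And>r. r \<in> m \<Longrightarrow> r \<otimes> b \<in> A"
  shows "ideal_length R A (A <+> PIdl b) \<le> 1"
proof (rule ideal_length_least)
  fix n N assume chain: "ideal_chain R A (A <+> PIdl b) n N"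
  show "enat n \<le> 1"
  proof (rule ccontr)
    assume "\<not> enat n \<le> 1"
    hence n: "1 < n" by (simp add: one_enat_def)
    hence N1: "ideal (N 1) R" "A \<subseteq> N 1" "N 1 \<subseteq> A <+> PIdl b"
      and N0: "A \<subseteq> N 0" "N 0 \<subset> N 1"
      and N2: "N 1 \<subset> N 2" "N 2 \<subseteq> A <+> PIdl b"
      using chain unfolding ideal_chain_def by (auto simp: numeral_2_eq_2)
    then obtain c where c: "c \<in> N 1" "c \<notin> A" by blast
    then obtain a r where ar: "a \<in> A" "r \<in> carrier R" "c = a \<oplus> r \<otimes> b"
      using N1(3) unfolding set_add_def' cgenideal_def by blast
    interpret A: ideal A R by fact
    interpret N1: ideal "N 1" R by fact
    have "r \<notin> m" using b(2)[of r] ar c by blast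
    have "\<ominus> a \<oplus> c \<in> N 1" using ar N1(2) c by blast
    hence "r \<otimes> b \<in> N 1" using ar b by (simp add: r_neg1 A.Icarr)
    hence "b \<in> N 1" using unit_multiple_mem[OF N1(1) ar(2) \<open>r \<notin> m\<close> b(1)] by blast
    hence "A <+> PIdl b \<subseteq> N 1"
      using N1 by (intro add_ideals_least cgenideal_minimal)
    thus False using N2 by blast
  qed
qed

text \<open>Noetherian induction: let \<open>B\<close> be maximal among the ideals above \<open>A\<close> of infinite colength. Adding to
\<open>B\<close> a socle element of \<open>R/B\<close> costs length at most one and leads to an ideal of finite colength.\<close>

lemma finite_colength:
  assumes A: "ideal A R" and prime: "\<And>P. primeideal P R \<Longrightarrow> A \<subseteq> P \<Longrightarrow> P = m"
  shows "ideal_length R A (carrier R) \<noteq> \<infinity>"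
proof
  assume inf: "ideal_length R A (carrier R) = \<infinity>"
  obtain B where B: "ideal B R \<and> A \<subseteq> B \<and> ideal_length R B (carrier R) = \<infinity>"
    and max: "\<And>I. ideal I R \<and> A \<subseteq> I \<and> ideal_length R I (carrier R) = \<infinity> \<Longrightarrow> B \<subseteq> I \<Longrightarrow> I = B"
    by (rule exists_maximal_ideal_with
        [of "\<lambda>I. ideal I R \<and> A \<subseteq> I \<and> ideal_length R I (carrier R) = \<infinity>" A])
      (use A inf in auto)
  hence B: "ideal B R" "A \<subseteq> B" "ideal_length R B (carrier R) = \<infinity>" by auto
  have "ideal_length R (carrier R) (carrier R) \<le> 0"
  proof (rule ideal_length_least)
    fix n N assume "ideal_chain R (carrier R) (carrier R) n N"
    hence "n = 0" unfolding ideal_chain_def by (metis Suc_leI gr_zeroI le0 psubset_eq subset_antisym)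
    thus "enat n \<le> 0" by (simp add: zero_enat_def)
  qed
  hence "B \<noteq> carrier R" using B by auto
  then obtain b where b: "b \<in> carrier R" "b \<notin> B" "\<And>r. r \<in> m \<Longrightarrow> r \<otimes> b \<in> B"
    using socle_element[OF B(1)] prime B(2) by blast
  let ?B = "B <+> PIdl b"
  have id: "ideal ?B R" using B b by (intro add_ideals cgenideal_ideal)
  have up: "B \<subseteq> ?B" "b \<in> ?B"
    using add_ideals_upper[OF B(1) cgenideal_ideal[OF b(1)]] cgenideal_self[OF b(1)] by auto
  have "ideal_length R ?B (carrier R) \<noteq> \<infinity>"
  proof
    assume "ideal_length R ?B (carrier R) = \<infinity>"
    hence "?B = B" using max[of ?B] id up B(2) by blast
    thus False using up b(2) by blast
  qed
  moreover have "ideal_length R B ?B \<noteq> \<infinity>"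
    using ideal_length_socle_le[OF B(1) b(1,3)] by (auto simp: one_enat_def dest: enat_ile)
  moreover have "ideal_length R B (carrier R) = ideal_length R B ?B + ideal_length R ?B (carrier R)"
    using id B oneideal up additive_subgroup.a_subset[OF ideal.axioms(1)[OF id]]
    by (intro ideal_length_add) auto
  ultimately show False using B(3) by auto
qed

text \<open>If \<open>N' \<noteq> N\<close>, take an ideal \<open>M\<close> that is maximal among the proper subideals of \<open>N\<close> containing \<open>N'\<close>.
Then \<open>N/M\<close> is simple, so \<open>m\<close> kills it, and \<open>N' + mN \<subseteq> M\<close> is too small.\<close>

lemma nakayama:
  assumes N: "ideal N R" and N': "ideal N' R" "N' \<subseteq> N" and gen: "N \<subseteq> N' <+> m \<cdot> N"
  shows "N' = N"
proof (rule ccontr)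
  assume "N' \<noteq> N"
  obtain M where M: "ideal M R \<and> N' \<subseteq> M \<and> M \<subset> N"
    and max: "\<And>I. ideal I R \<and> N' \<subseteq> I \<and> I \<subset> N \<Longrightarrow> M \<subseteq> I \<Longrightarrow> I = M"
    by (rule exists_maximal_ideal_with[of "\<lambda>I. ideal I R \<and> N' \<subseteq> I \<and> I \<subset> N" N'])
      (use N' \<open>N' \<noteq> N\<close> in auto)
  hence M: "ideal M R" "N' \<subseteq> M" "M \<subset> N" by auto
  interpret M: ideal M R by fact
  interpret N: ideal N R by fact
  have prod: "a \<otimes> s \<in> M" if a: "a \<in> m" and s: "s \<in> N" for a s
  proof (rule ccontr)
    assume as: "a \<otimes> s \<notin> M"
    have ac: "a \<in> carrier R" using a m_subset by blast
    have sc: "s \<in> carrier R" using s by (rule N.Icarr)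
    have asc: "a \<otimes> s \<in> carrier R" using ac sc by simp
    let ?I = "M <+> PIdl (a \<otimes> s)"
    have id: "ideal ?I R" using M asc by (intro add_ideals cgenideal_ideal)
    have up: "M \<subseteq> ?I" "a \<otimes> s \<in> ?I"
      using add_ideals_upper[OF M(1) cgenideal_ideal[OF asc]] cgenideal_self[OF asc] by auto
    have "?I \<subseteq> N"
      using M N s ac by (intro add_ideals_least cgenideal_minimal N.I_l_closed) auto
    moreover have "\<not> ?I \<subset> N" using max[of ?I] id M(2) up as by blast
    \<comment> \<open>Maximality of \<open>M\<close> makes \<open>M + (a s)\<close> equal to \<open>N\<close>, so \<open>s\<close> is congruent modulo \<open>M\<close> to a multiple of \<open>a s\<close>.\<close>
    ultimately have "s \<in> ?I" using s by blast
    then obtain b r where br: "b \<in> M" "r \<in> carrier R" "s = b \<oplus> r \<otimes> (a \<otimes> s)"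
      unfolding set_add_def' cgenideal_def by blast
    have ra: "r \<otimes> a \<in> m" using a br by (intro ideal.I_l_closed[OF m_ideal])
    have "(\<one> \<ominus> r \<otimes> a) \<otimes> s = s \<ominus> r \<otimes> (a \<otimes> s)"
      using br ac sc by (simp add: a_minus_def l_distr l_minus m_assoc)
    also have "\<dots> = b"
    proof -
      have "s \<ominus> t = b" if "t \<in> carrier R" "s = b \<oplus> t" for t
        using that br(1) M.Icarr by (simp add: a_minus_def a_assoc r_neg)
      from this[OF _ br(3)] show ?thesis using br(2) asc by simp
    qed
    finally have "(\<one> \<ominus> r \<otimes> a) \<otimes> s \<in> M" using br by simp
    hence "s \<in> M"
      using unit_multiple_mem[OF M(1) _ one_minus_notin_m[OF ra] sc] br ac by simp
    thus False using as ac M.I_l_closed by blast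
  qed
  have "m \<cdot> N \<subseteq> M"
  proof
    fix t assume "t \<in> m \<cdot> N"
    thus "t \<in> M" by induct (use prod in auto)
  qed
  hence "N \<subseteq> M" using gen add_ideals_least[OF M(1,2)] by blast
  thus False using M by blast
qed

end

section \<open>Powers and reductions of ideals\<close>

context cring
begin

lemma ideal_pow_0 [simp]: "ideal_pow R K 0 = carrier R"
  by (simp add: ideal_pow_def)

lemma ideal_pow_Suc: "ideal_pow R K (Suc n) = K \<cdot> ideal_pow R K n"
  by (simp add: ideal_pow_def)

lemma ideal_pow_ideal [intro]: "ideal K R \<Longrightarrow> ideal (ideal_pow R K n) R"
  by (induction n) (simp_all add: ideal_pow_Suc oneideal ideal_prod_is_ideal)

lemma ideal_prod_left_commute:
  assumes "ideal A R" "ideal B R" "ideal C R"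
  shows "A \<cdot> (B \<cdot> C) = B \<cdot> (A \<cdot> C)"
  using assms by (metis ideal_prod_assoc ideal_prod_commute)

lemma ideal_pow_add:
  assumes "ideal K R"
  shows "ideal_pow R K (i + j) = ideal_pow R K i \<cdot> ideal_pow R K j"
proof (induction i)
  case 0
  have "carrier R \<cdot> ideal_pow R K j = ideal_pow R K j"
    using ideal_prod_commute[OF oneideal ideal_pow_ideal] ideal_prod_one[OF ideal_pow_ideal] assms
    by metis
  thus ?case by simp
next
  case (Suc i)
  thus ?case using assms by (simp add: ideal_pow_Suc ideal_prod_assoc ideal_pow_ideal)
qed

lemma ideal_pow_mono: "K \<subseteq> L \<Longrightarrow> ideal_pow R K n \<subseteq> ideal_pow R L n"
  by (induction n) (simp_all add: ideal_pow_Suc ideal_prod_mono)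

lemma PIdl_prod_PIdl:
  assumes "a \<in> carrier R" "b \<in> carrier R"
  shows "(PIdl a) \<cdot> (PIdl b) = PIdl (a \<otimes> b)"
proof -
  have "s \<in> (PIdl a) \<cdot> (PIdl b) \<longleftrightarrow> s \<in> PIdl (a \<otimes> b)" for s
    unfolding mem_PIdl_prod_iff[OF assms(1) cgenideal_ideal[OF assms(2)]]
    using assms by (auto simp: cgenideal_def m_lcomm)
  thus ?thesis by blast
qed

definition is_reduction :: "'a set \<Rightarrow> 'a set \<Rightarrow> bool" where
  "is_reduction L K \<longleftrightarrow> ideal L R \<and> ideal K R \<and> L \<subseteq> K \<and>
     (\<exists>n. ideal_pow R K (Suc n) \<subseteq> L \<cdot> ideal_pow R K n)"

text \<open>Iterating \<open>M\<^sup>p\<^sup>+\<^sup>1 \<subseteq> K M\<^sup>p\<close> moves all but \<open>p\<close> factors of a power of \<open>M\<close> into \<open>K\<close>, and enough factors \<open>K\<close>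
release one factor \<open>L\<close>.\<close>

lemma is_reduction_trans:
  assumes "is_reduction L K" "is_reduction K M"
  shows "is_reduction L M"
proof -
  obtain n p where n: "ideal_pow R K (Suc n) \<subseteq> L \<cdot> ideal_pow R K n"
    and p: "ideal_pow R M (Suc p) \<subseteq> K \<cdot> ideal_pow R M p"
    using assms unfolding is_reduction_def by blast
  have id: "ideal L R" "ideal K R" "ideal M R" and sub: "L \<subseteq> K" "K \<subseteq> M"
    using assms unfolding is_reduction_def by auto
  have pows: "ideal (ideal_pow R K j) R" "ideal (ideal_pow R M j) R" for j
    using id by auto
  have *: "ideal_pow R M (j + p) \<subseteq> ideal_pow R K j \<cdot> ideal_pow R M p" for j
  proof (induction j)
    case 0
    show ?case using ideal_pow_add[OF id(3), of 0 p] by simp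
  next
    case (Suc j)
    have "ideal_pow R M (Suc j + p) = M \<cdot> ideal_pow R M (j + p)"
      by (simp add: ideal_pow_Suc)
    also have "\<dots> \<subseteq> M \<cdot> (ideal_pow R K j \<cdot> ideal_pow R M p)"
      using Suc by (rule ideal_prod_mono[OF order_refl])
    also have "\<dots> = ideal_pow R K j \<cdot> ideal_pow R M (Suc p)"
      unfolding ideal_pow_Suc by (rule ideal_prod_left_commute) (use id pows in auto)
    also have "\<dots> \<subseteq> ideal_pow R K j \<cdot> (K \<cdot> ideal_pow R M p)"
      using p by (rule ideal_prod_mono[OF order_refl])
    also have "\<dots> = ideal_pow R K (Suc j) \<cdot> ideal_pow R M p"
      unfolding ideal_pow_Suc using id pows
      by (metis ideal_prod_assoc ideal_prod_left_commute)
    finally show ?case .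
  qed
  have "ideal_pow R M (Suc n + p) \<subseteq> ideal_pow R K (Suc n) \<cdot> ideal_pow R M p" by (rule *)
  also have "\<dots> \<subseteq> (L \<cdot> ideal_pow R K n) \<cdot> ideal_pow R M p"
    using n by (rule ideal_prod_mono) simp
  also have "\<dots> \<subseteq> (L \<cdot> ideal_pow R M n) \<cdot> ideal_pow R M p"
    by (intro ideal_prod_mono ideal_pow_mono sub order_refl)
  also have "\<dots> = L \<cdot> ideal_pow R M (n + p)"
    unfolding ideal_pow_add[OF id(3)] by (rule ideal_prod_assoc) (use id pows in auto)
  finally have "ideal_pow R M (Suc (n + p)) \<subseteq> L \<cdot> ideal_pow R M (n + p)" by simp
  thus ?thesis unfolding is_reduction_def using id sub by blast
qed

text \<open>Every product of \<open>j + 1\<close> factors from \<open>K + A\<close> lies in \<open>K\<^sup>j\<^sup>+\<^sup>1\<close> or contains a factor from \<open>A\<close>.\<close>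

lemma is_reduction_add:
  assumes red: "is_reduction L K" and A: "ideal A R"
  shows "is_reduction (L <+> A) (K <+> A)"
proof -
  obtain n where n: "ideal_pow R K (Suc n) \<subseteq> L \<cdot> ideal_pow R K n"
    using red unfolding is_reduction_def by blast
  have id: "ideal L R" "ideal K R" and sub: "L \<subseteq> K"
    using red unfolding is_reduction_def by auto
  let ?B = "K <+> A"
  have B: "ideal ?B R" "K \<subseteq> ?B" "A \<subseteq> ?B"
    using add_ideals[OF id(2) A] add_ideals_upper[OF id(2) A] by auto
  have LA: "ideal (L <+> A) R" "L \<subseteq> L <+> A" "A \<subseteq> L <+> A"
    using add_ideals[OF id(1) A] add_ideals_upper[OF id(1) A] by auto
  have pows: "ideal (ideal_pow R K j) R" "ideal (ideal_pow R ?B j) R" for j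
    using id B by auto
  have *: "ideal_pow R ?B (Suc j) \<subseteq> ideal_pow R K (Suc j) <+> A \<cdot> ideal_pow R ?B j" for j
  proof (induction j)
    case 0
    show ?case using id A B by (simp add: ideal_pow_Suc ideal_prod_one)
  next
    case (Suc j)
    let ?T = "ideal_pow R K (Suc (Suc j)) <+> A \<cdot> ideal_pow R ?B (Suc j)"
    have AB: "ideal (A \<cdot> ideal_pow R ?B i) R" for i
      using A pows by (intro ideal_prod_is_ideal)
    have T: "ideal ?T R" "ideal_pow R K (Suc (Suc j)) \<subseteq> ?T" "A \<cdot> ideal_pow R ?B (Suc j) \<subseteq> ?T"
      using add_ideals[OF pows(1) AB] add_ideals_upper[OF pows(1) AB] by auto
    have "K \<cdot> ideal_pow R ?B (Suc j) \<subseteq> K \<cdot> (ideal_pow R K (Suc j) <+> A \<cdot> ideal_pow R ?B j)"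
      using Suc by (rule ideal_prod_mono[OF order_refl])
    also have "\<dots> = K \<cdot> ideal_pow R K (Suc j) <+> K \<cdot> (A \<cdot> ideal_pow R ?B j)"
      by (rule ideal_prod_r_distr) (use id pows AB in auto)
    also have "\<dots> \<subseteq> ?T"
    proof (rule add_ideals_least[OF T(1)])
      show "K \<cdot> ideal_pow R K (Suc j) \<subseteq> ?T" using T(2) by (simp only: ideal_pow_Suc)
      have "K \<cdot> (A \<cdot> ideal_pow R ?B j) = A \<cdot> (K \<cdot> ideal_pow R ?B j)"
        by (rule ideal_prod_left_commute) (use id A pows in auto)
      also have "\<dots> \<subseteq> A \<cdot> (?B \<cdot> ideal_pow R ?B j)"
        using B by (intro ideal_prod_mono order_refl)
      also have "\<dots> \<subseteq> ?T" using T(3) by (simp only: ideal_pow_Suc)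
      finally show "K \<cdot> (A \<cdot> ideal_pow R ?B j) \<subseteq> ?T" .
    qed
    finally have K: "K \<cdot> ideal_pow R ?B (Suc j) \<subseteq> ?T" .
    have "ideal_pow R ?B (Suc (Suc j)) = ?B \<cdot> ideal_pow R ?B (Suc j)"
      by (rule ideal_pow_Suc)
    also have "\<dots> = K \<cdot> ideal_pow R ?B (Suc j) <+> A \<cdot> ideal_pow R ?B (Suc j)"
      by (rule ideal_prod_distr(2)) (use id A pows in auto)
    also have "\<dots> \<subseteq> ?T" using T K by (intro add_ideals_least)
    finally show ?case .
  qed
  have "ideal_pow R ?B (Suc n) \<subseteq> ideal_pow R K (Suc n) <+> A \<cdot> ideal_pow R ?B n" by (rule *)
  also have "\<dots> \<subseteq> (L <+> A) \<cdot> ideal_pow R ?B n"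
  proof (rule add_ideals_least)
    show "ideal ((L <+> A) \<cdot> ideal_pow R ?B n) R" using LA pows by (intro ideal_prod_is_ideal)
    show "A \<cdot> ideal_pow R ?B n \<subseteq> (L <+> A) \<cdot> ideal_pow R ?B n"
      using LA by (intro ideal_prod_mono order_refl)
    have "L \<cdot> ideal_pow R K n \<subseteq> (L <+> A) \<cdot> ideal_pow R ?B n"
      using LA B by (intro ideal_prod_mono ideal_pow_mono)
    thus "ideal_pow R K (Suc n) \<subseteq> (L <+> A) \<cdot> ideal_pow R ?B n" using n by blast
  qed
  finally have "ideal_pow R ?B (Suc n) \<subseteq> (L <+> A) \<cdot> ideal_pow R ?B n" .
  moreover have "L <+> A \<subseteq> ?B" using B sub by (intro add_ideals_least) auto
  ultimately show ?thesis unfolding is_reduction_def using LA B by blast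
qed

lemma regular_element_pow: "regular_element x \<Longrightarrow> regular_element (x [^] (n::nat))"
proof (induction n)
  case (Suc n)
  have reg: "regular_element (x [^] n)" by (rule Suc.IH[OF Suc.prems])
  have x: "x \<in> carrier R" using Suc.prems by (simp add: regular_element_def)
  show ?case unfolding regular_element_def
  proof (intro conjI ballI impI)
    fix r assume r: "r \<in> carrier R" "x [^] Suc n \<otimes> r = \<zero>"
    hence "x [^] n \<otimes> (x \<otimes> r) = \<zero>" using x by (simp add: m_assoc)
    hence "x \<otimes> r = \<zero>" using reg r(1) x by (simp add: regular_element_def)
    thus "r = \<zero>" using Suc.prems r(1) by (simp add: regular_element_def)
  qed (use x in simp)
qed (simp add: regular_element_def)

text \<open>A power of \<open>x\<close> is a multiple of \<open>z\<close>.\<close>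

lemma reduction_generator_regular:
  assumes red: "is_reduction (PIdl z) K" and z: "z \<in> carrier R"
    and x: "x \<in> K" "regular_element x"
  shows "regular_element z"
proof -
  obtain n where n: "ideal_pow R K (Suc n) \<subseteq> (PIdl z) \<cdot> ideal_pow R K n"
    and K: "ideal K R"
    using red unfolding is_reduction_def by blast
  have xc: "x \<in> carrier R" using x by (simp add: regular_element_def)
  have "x [^] k \<in> ideal_pow R K k" for k
  proof (induction k)
    case (Suc k)
    hence "x \<otimes> x [^] k \<in> ideal_pow R K (Suc k)"
      unfolding ideal_pow_Suc using x by (intro ideal_prod.prod)
    thus ?case using xc by (simp add: m_comm)
  qed simp
  hence "x [^] Suc n \<in> (PIdl z) \<cdot> ideal_pow R K n" using n by blast
  then obtain c where c: "c \<in> ideal_pow R K n" "x [^] Suc n = z \<otimes> c"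
    using mem_PIdl_prod_iff[OF z ideal_pow_ideal[OF K]] by blast
  have cc: "c \<in> carrier R" using c ideal.Icarr[OF ideal_pow_ideal[OF K]] by blast
  have reg: "regular_element (x [^] Suc n)" using x(2) by (rule regular_element_pow)
  show ?thesis unfolding regular_element_def
  proof (intro conjI ballI impI z)
    fix r assume r: "r \<in> carrier R" "z \<otimes> r = \<zero>"
    have "x [^] Suc n \<otimes> r = c \<otimes> (z \<otimes> r)" unfolding c(2) using z cc r(1) by (simp add: m_ac)
    also have "\<dots> = \<zero>" using r cc by simp
    finally show "r = \<zero>" using reg r(1) unfolding regular_element_def by blast
  qed
qed

lemma finprod_mem_ideal_pow:
  assumes "finite A" "ideal K R" "\<And>i. i \<in> A \<Longrightarrow> z i \<in> K"
  shows "finprod R z A \<in> ideal_pow R K (card A)"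
  using assms(1,3)
proof (induction A)
  case (insert a A)
  have "z \<in> A \<rightarrow> carrier R" "z a \<in> carrier R"
    using insert.prems ideal.Icarr[OF assms(2)] by auto
  hence "finprod R z (insert a A) = z a \<otimes> finprod R z A"
    using insert by (intro finprod_insert) auto
  thus ?case using insert by (auto simp: ideal_pow_Suc intro: ideal_prod.prod)
qed simp

text \<open>Modulo \<open>z0\<close> each \<open>z i\<close> generates \<open>K\<close>, hence the product of the \<open>z i\<close> generates the power of \<open>K\<close> of
exponent \<open>card A\<close>. For empty \<open>A\<close> the exponent \<open>card A - 1\<close> is \<open>0\<close>, which is harmless as the last
summand is then the whole ring.\<close>

lemma ideal_pow_subset_product:
  assumes A: "finite A" and K: "ideal K R" and z0: "z0 \<in> K"
    and z: "\<And>i. i \<in> A \<Longrightarrow> z i \<in> K" "\<And>i. i \<in> A \<Longrightarrow> K \<subseteq> PIdl z0 <+> PIdl (z i)"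
  shows "ideal_pow R K (card A) \<subseteq> (PIdl z0) \<cdot> ideal_pow R K (card A - 1) <+> PIdl (finprod R z A)"
  using A z
proof (induction A)
  case empty
  have "ideal ((PIdl z0) \<cdot> carrier R) R"
    using ideal.Icarr[OF K z0] by (intro ideal_prod_is_ideal cgenideal_ideal oneideal)
  hence "PIdl \<one> \<subseteq> (PIdl z0) \<cdot> carrier R <+> PIdl \<one>"
    by (rule add_ideals_upper) (simp add: cgenideal_ideal)
  thus ?case using cgenideal_eq_genideal[of \<one>] genideal_one by simp
next
  case (insert a A)
  have z0c: "z0 \<in> carrier R" using ideal.Icarr[OF K z0] .
  have zc: "z a \<in> carrier R" "z \<in> A \<rightarrow> carrier R"
    using insert.prems ideal.Icarr[OF K] by auto
  define \<pi> where "\<pi> = finprod R z A"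
  define k where "k = card A"
  have \<pi>: "\<pi> \<in> carrier R" "\<pi> \<in> ideal_pow R K k"
    unfolding \<pi>_def k_def using zc insert by (auto intro!: finprod_mem_ideal_pow K)
  have prod: "finprod R z (insert a A) = z a \<otimes> \<pi>"
    unfolding \<pi>_def using insert zc by (intro finprod_insert) auto
  have pow: "ideal (ideal_pow R K j) R" for j using K by blast
  have z0K: "ideal ((PIdl z0) \<cdot> ideal_pow R K j) R" for j
    using pow z0c by (intro ideal_prod_is_ideal cgenideal_ideal)
  let ?T = "(PIdl z0) \<cdot> ideal_pow R K k <+> PIdl (z a \<otimes> \<pi>)"
  have P: "ideal (PIdl (z a \<otimes> \<pi>)) R" using zc \<pi> by (intro cgenideal_ideal) simp
  have T: "ideal ?T R" "(PIdl z0) \<cdot> ideal_pow R K k \<subseteq> ?T" "PIdl (z a \<otimes> \<pi>) \<subseteq> ?T"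
    using add_ideals[OF z0K P] add_ideals_upper[OF z0K P] by auto
  have "ideal_pow R K (Suc k) = K \<cdot> ideal_pow R K k" by (rule ideal_pow_Suc)
  also have "\<dots> \<subseteq> K \<cdot> ((PIdl z0) \<cdot> ideal_pow R K (k - 1) <+> PIdl \<pi>)"
    unfolding k_def \<pi>_def using insert by (intro ideal_prod_mono order_refl) auto
  also have "\<dots> = K \<cdot> ((PIdl z0) \<cdot> ideal_pow R K (k - 1)) <+> K \<cdot> (PIdl \<pi>)"
    by (rule ideal_prod_r_distr) (use K z0K \<pi> cgenideal_ideal in auto)
  also have "\<dots> \<subseteq> ?T"
  proof (rule add_ideals_least[OF T(1)])
    have "K \<cdot> ((PIdl z0) \<cdot> ideal_pow R K (k - 1)) = (PIdl z0) \<cdot> (K \<cdot> ideal_pow R K (k - 1))"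
      by (rule ideal_prod_left_commute) (use K z0c cgenideal_ideal pow in auto)
    also have "K \<cdot> ideal_pow R K (k - 1) \<subseteq> ideal_pow R K k"
      using ideal_prod_in_carrier[OF K pow[of "k - 1"]]
      by (cases k) (auto simp: ideal_pow_Suc)
    hence "(PIdl z0) \<cdot> (K \<cdot> ideal_pow R K (k - 1)) \<subseteq> (PIdl z0) \<cdot> ideal_pow R K k"
      by (intro ideal_prod_mono order_refl)
    finally show "K \<cdot> ((PIdl z0) \<cdot> ideal_pow R K (k - 1)) \<subseteq> ?T" using T(2) by blast
  next
    have "K \<cdot> (PIdl \<pi>) \<subseteq> (PIdl z0 <+> PIdl (z a)) \<cdot> (PIdl \<pi>)"
      using insert.prems(2)[of a] by (intro ideal_prod_mono) auto
    also have "\<dots> = (PIdl z0) \<cdot> (PIdl \<pi>) <+> (PIdl (z a)) \<cdot> (PIdl \<pi>)"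
      by (rule ideal_prod_distr(2)) (use z0c zc \<pi> cgenideal_ideal in auto)
    also have "\<dots> \<subseteq> ?T"
    proof (rule add_ideals_least[OF T(1)])
      have "(PIdl z0) \<cdot> (PIdl \<pi>) \<subseteq> (PIdl z0) \<cdot> ideal_pow R K k"
        using \<pi> pow by (intro ideal_prod_mono cgenideal_minimal order_refl)
      thus "(PIdl z0) \<cdot> (PIdl \<pi>) \<subseteq> ?T" using T(2) by blast
      show "(PIdl (z a)) \<cdot> (PIdl \<pi>) \<subseteq> ?T" using T(3) zc \<pi> by (simp add: PIdl_prod_PIdl)
    qed
    finally show "K \<cdot> (PIdl \<pi>) \<subseteq> ?T" .
  qed
  finally show ?case using insert.hyps prod by (simp add: k_def)
qed

lemma primeideal_finprod:
  assumes P: "primeideal P R" and "finite A" "z \<in> A \<rightarrow> carrier R" "finprod R z A \<in> P"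
  shows "\<exists>i\<in>A. z i \<in> P"
  using assms(2-)
proof (induction A)
  case empty
  thus ?case using primeideal.I_notcarr[OF P] ideal.one_imp_carrier[OF primeideal.axioms(1)[OF P]] by auto
next
  case (insert a A)
  have z: "z a \<in> carrier R" "z \<in> A \<rightarrow> carrier R" using insert.prems by auto
  have "finprod R z (insert a A) = z a \<otimes> finprod R z A"
    using insert z by (intro finprod_insert) auto
  hence "z a \<otimes> finprod R z A \<in> P" using insert.prems by simp
  hence "z a \<in> P \<or> finprod R z A \<in> P"
    using primeideal.I_prime[OF P] z by auto
  thus ?case using insert.IH z by blast
qed

end

section \<open>Principal reductions in dimension one\<close>

context noetherian_local_ring
begin

lemma exists_regular_element_in_m:
  assumes "ring_depth R m \<noteq> 0"
  shows "\<exists>x\<in>m. regular_element x"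
proof -
  have "\<exists>xs. set xs \<subseteq> m \<and> regular_sequence R xs \<and> xs \<noteq> []"
  proof (rule ccontr)
    assume none: "\<not> ?thesis"
    have "ring_depth R m \<le> 0"
      unfolding ring_depth_def
    proof (rule SUP_least)
      fix xs assume "xs \<in> {xs. set xs \<subseteq> m \<and> regular_sequence R xs}"
      hence "xs = []" using none by blast
      thus "enat (length xs) \<le> 0" by (simp add: zero_enat_def)
    qed
    thus False using assms by simp
  qed
  then obtain xs where xs: "set xs \<subseteq> m" "regular_sequence R xs" "xs \<noteq> []" by blast
  have x: "xs ! 0 \<in> set xs" using xs(3) by simp
  have "Idl {} \<subseteq> {\<zero>}" by (rule genideal_minimal[OF zeroideal]) simp
  moreover have "\<zero> \<in> Idl {}"
    using genideal_ideal[of "{}"] by (simp add: additive_subgroup.zero_closed ideal.axioms(1))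
  ultimately have Idl: "Idl {} = {\<zero>}" by blast
  have "\<forall>r\<in>carrier R. xs ! 0 \<otimes> r \<in> Idl (set (take 0 xs)) \<longrightarrow> r \<in> Idl (set (take 0 xs))"
    using xs(2,3) unfolding regular_sequence_def by blast
  hence "regular_element (xs ! 0)"
    using x xs(1) m_subset unfolding regular_element_def by (auto simp: Idl)
  thus ?thesis using x xs(1) by blast
qed

text \<open>If \<open>P\<close> were smaller than \<open>m\<close>, a chain \<open>Q \<subset> P \<subset> m\<close> would contradict dimension one. Such a \<open>Q\<close> is a
prime that avoids all \<open>s x\<^sup>n\<close> with \<open>s \<notin> P\<close>; regularity of \<open>x\<close> ensures that \<open>\<zero>\<close> is not among these
elements.\<close>

lemma prime_containing_regular_element:
  assumes dim: "krull_dim R \<le> 1" and x: "regular_element x" and P: "primeideal P R" "x \<in> P"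
  shows "P = m"
proof (rule ccontr)
  assume "P \<noteq> m"
  interpret P: primeideal P R by fact
  have "P \<subset> m" using proper_ideal_subset_m[OF P.is_ideal] P.I_notcarr \<open>P \<noteq> m\<close> by blast
  have xc: "x \<in> carrier R" using x by (simp add: regular_element_def)
  define S where "S = {s \<otimes> x [^] (n::nat) | s n. s \<in> carrier R - P}"
  have one: "\<one> \<in> carrier R - P" using P.I_notcarr P.one_imp_carrier by auto
  have memS: "s \<otimes> x [^] n \<in> S" if "s \<in> carrier R" "s \<notin> P" for s and n :: nat
    using that unfolding S_def by blast
  have "\<exists>Q. primeideal Q R \<and> {\<zero>} \<subseteq> Q \<and> Q \<inter> S = {}"
  proof (rule exists_prime_avoiding[OF zeroideal])
    show "S \<subseteq> carrier R" unfolding S_def using xc by auto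
    show "\<one> \<in> S" using memS[of \<one> 0] one by simp
  next
    fix a b assume "a \<in> S" "b \<in> S"
    then obtain s t and i j :: nat where st: "s \<in> carrier R" "s \<notin> P" "t \<in> carrier R" "t \<notin> P"
      and ab: "a = s \<otimes> x [^] i" "b = t \<otimes> x [^] j"
      unfolding S_def by blast
    have "a \<otimes> b = (s \<otimes> t) \<otimes> x [^] (i + j)"
      using st xc by (simp add: ab m_ac flip: nat_pow_mult)
    moreover have "s \<otimes> t \<notin> P" using st P.I_prime by blast
    ultimately show "a \<otimes> b \<in> S" using memS[of "s \<otimes> t" "i + j"] st by simp
  next
    have "s \<otimes> x [^] n \<noteq> \<zero>" if s: "s \<in> carrier R" "s \<notin> P" for s and n :: nat
    proof
      assume "s \<otimes> x [^] n = \<zero>"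
      hence "x [^] n \<otimes> s = \<zero>" using s xc by (simp add: m_comm)
      hence "s = \<zero>" using regular_element_pow[OF x, of n] s unfolding regular_element_def by blast
      thus False using s by simp
    qed
    thus "{\<zero>} \<inter> S = {}" unfolding S_def by fastforce
  qed
  then obtain Q where Q: "primeideal Q R" "Q \<inter> S = {}" by blast
  interpret Q: primeideal Q R by fact
  have "Q \<subseteq> P"
  proof
    fix q assume q: "q \<in> Q"
    hence "q \<otimes> x [^] (0::nat) \<notin> S" using Q(2) by auto
    thus "q \<in> P" using memS[of q 0] q by auto
  qed
  moreover have "x \<notin> Q" using memS[of \<one> 1] one xc Q(2) by auto
  ultimately have "Q \<subset> P" using P(2) by blast
  have "primeideal m R" by (rule maximalideal_prime[OF maximal])
  let ?c = "\<lambda>i::nat. if i = 0 then Q else if i = 1 then P else m"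
  have "\<forall>i\<le>2. primeideal (?c i) R" using Q P \<open>primeideal m R\<close> by simp
  moreover have "\<forall>i<2. ?c i \<subset> ?c (Suc i)"
    using \<open>Q \<subset> P\<close> \<open>P \<subset> m\<close> by (simp add: less_2_cases_iff)
  ultimately have "enat 2 \<le> krull_dim R"
    unfolding krull_dim_def by (intro SUP_upper CollectI exI[of _ ?c] conjI)
  hence "enat 2 \<le> 1" using dim by (rule order_trans)
  thus False by (simp add: one_enat_def)
qed

lemma exists_incongruent_elements:
  assumes "infinite (carrier (R Quot m))"
  shows "\<exists>U\<subseteq>carrier R. finite U \<and> card U = k \<and> (\<forall>u\<in>U. \<forall>v\<in>U. u \<noteq> v \<longrightarrow> u \<ominus> v \<notin> m)"
proof -
  obtain B where B: "finite B" "card B = k" "B \<subseteq> carrier (R Quot m)"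
    using infinite_arbitrarily_large[OF assms] by blast
  have "carrier (R Quot m) = (+>) m ` carrier R"
    unfolding FactRing_def A_RCOSETS_def' by auto
  then obtain U where U: "U \<subseteq> carrier R" "inj_on ((+>) m) U" "B = (+>) m ` U"
    using B(3) by (auto simp: subset_image_inj)
  have "finite U" "card U = k" using B U by (auto simp: finite_image_iff card_image)
  moreover have "u \<ominus> v \<notin> m" if "u \<in> U" "v \<in> U" "u \<noteq> v" for u v
    using that U quotient_eq_iff_same_a_r_cos[OF m_ideal, of u v] by (auto dest: inj_onD)
  ultimately show ?thesis using U(1) by blast
qed

text \<open>The heart of the existence of reductions, with \<open>K = (x, y)\<close> and \<open>n\<close> the length of \<open>R/xR\<close>. Choose
\<open>n + 1\<close> elements \<open>u\<close> that are pairwise incongruent modulo \<open>m\<close>, and put \<open>z u = x + u y\<close>. Any two of the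
\<open>z u\<close> generate \<open>K\<close>, because the difference of two of them is a unit times \<open>y\<close>. Let \<open>g u\<close> be the
product of all \<open>z v\<close> with \<open>v \<noteq> u\<close>. The ideal \<open>N\<close> generated by the \<open>n + 1\<close> elements \<open>g u\<close> satisfies
\<open>length (N/mN) \<le> length (N/xN) = n\<close>, so some \<open>g j\<close> is redundant by Nakayama's lemma. All the other
\<open>g i\<close> contain the factor \<open>z j\<close>, hence \<open>g j\<close> lies in \<open>z j K\<^sup>n\<^sup>-\<^sup>1\<close>. As \<open>K\<close> equals \<open>(z j, z i)\<close> for each
\<open>i \<noteq> j\<close>, the power \<open>K\<^sup>n\<close> is contained in \<open>z j K\<^sup>n\<^sup>-\<^sup>1 + (g j)\<close>, and so in \<open>z j K\<^sup>n\<^sup>-\<^sup>1\<close>.\<close>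

lemma exists_reduction_of_two_generated:
  assumes inf: "infinite (carrier (R Quot m))"
    and x: "regular_element x" "x \<in> m" and y: "y \<in> carrier R"
    and prime: "\<And>P. primeideal P R \<Longrightarrow> x \<in> P \<Longrightarrow> P = m"
  shows "\<exists>z\<in>carrier R. is_reduction (PIdl z) (PIdl x <+> PIdl y)"
proof -
  let ?K = "PIdl x <+> PIdl y"
  have xc: "x \<in> carrier R" using x m_subset by blast
  have X: "ideal (PIdl x) R" and Y: "ideal (PIdl y) R" using xc y by (auto intro: cgenideal_ideal)
  have K: "ideal ?K R" by (rule add_ideals[OF X Y])
  interpret K: ideal ?K R by (rule K)
  have xyK: "x \<in> ?K" "y \<in> ?K"
    using add_ideals_upper[OF X Y] cgenideal_self xc y by auto
  have "ideal_length R (PIdl x) (carrier R) \<noteq> \<infinity>"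
    by (rule finite_colength[OF X]) (use prime cgenideal_self[OF xc] in blast)
  then obtain n where n: "ideal_length R (PIdl x) (carrier R) = enat n" by auto
  have "PIdl x \<subset> carrier R"
    using cgenideal_minimal[OF m_ideal x(2)] one_notin_m X
    by (metis additive_subgroup.a_subset ideal.axioms(1) one_closed psubsetI subsetD)
  hence "n \<noteq> 0" using ideal_length_pos[OF X oneideal] n by (auto simp: one_enat_def)
  obtain U where U: "U \<subseteq> carrier R" "finite U" "card U = Suc n"
    and incong: "\<And>u v. u \<in> U \<Longrightarrow> v \<in> U \<Longrightarrow> u \<noteq> v \<Longrightarrow> u \<ominus> v \<notin> m"
    using exists_incongruent_elements[OF inf, of "Suc n"] by blast
  define z where "z u = x \<oplus> u \<otimes> y" for u
  have zK: "z u \<in> ?K" if "u \<in> U" for u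
    unfolding z_def using xyK U that by (intro K.a_closed K.I_l_closed) auto
  have zc: "z u \<in> carrier R" if "u \<in> U" for u using zK[OF that] by (rule K.Icarr)
  have K_subset: "?K \<subseteq> T" if T: "ideal T R" and uv: "u \<in> U" "v \<in> U" "u \<noteq> v" "z u \<in> T" "z v \<in> T"
    for T u v
  proof -
    interpret T: ideal T R by fact
    have c: "u \<in> carrier R" "v \<in> carrier R" using uv U by auto
    have "z u \<ominus> z v \<in> T" using uv unfolding a_minus_def by blast
    moreover have "z u \<ominus> z v = (u \<ominus> v) \<otimes> y"
      unfolding z_def using c xc y
      by (simp add: a_minus_def minus_add l_distr l_minus a_ac r_neg2)
    ultimately have yT: "y \<in> T" using unit_multiple_mem[OF T _ incong[OF uv(1-3)] y] c by simp
    have "z u \<ominus> u \<otimes> y \<in> T"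
      using uv(4) T.I_l_closed[OF yT c(1)] unfolding a_minus_def by blast
    moreover have "z u \<ominus> u \<otimes> y = x"
      unfolding z_def using c xc y by (simp add: a_minus_def a_assoc r_neg)
    ultimately show ?thesis using yT T by (intro add_ideals_least cgenideal_minimal) auto
  qed
  define g where "g u = finprod R z (U - {u})" for u
  have gc: "g u \<in> carrier R" for u unfolding g_def using zc by (intro finprod_closed) auto
  define N where "N = Idl (g ` U)"
  have N: "ideal N R" unfolding N_def using gc by (intro genideal_ideal) auto
  have gN: "g ` U \<subseteq> N" unfolding N_def using gc by (intro genideal_self) auto
  \<comment> \<open>A prime containing every \<open>g u\<close> contains two of the \<open>z u\<close>, hence \<open>x\<close>.\<close>
  have "ideal_length R N (carrier R) \<noteq> \<infinity>"
  proof (rule finite_colength[OF N])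
    fix P assume P: "primeideal P R" "N \<subseteq> P"
    have other: "\<exists>v\<in>U - {u}. z v \<in> P" if "u \<in> U" for u
    proof (rule primeideal_finprod[OF P(1)])
      show "finprod R z (U - {u}) \<in> P" using gN P(2) that unfolding g_def by blast
    qed (use U zc in auto)
    obtain u where "u \<in> U" using U by fastforce
    then obtain v where v: "v \<in> U" "z v \<in> P" using other by blast
    then obtain w where "w \<in> U" "w \<noteq> v" "z w \<in> P" using other[of v] by blast
    hence "?K \<subseteq> P" using K_subset[OF primeideal.axioms(1)[OF P(1)] v(1), of w] v by blast
    thus "P = m" using prime[OF P(1)] xyK by blast
  qed
  hence xN: "ideal_length R ((PIdl x) \<cdot> N) N = enat n"
    using ideal_length_regular_multiple[OF x(1) N] n by simp
  have mN: "ideal (m \<cdot> N) R" by (rule ideal_prod_is_ideal[OF m_ideal N])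
  have "(PIdl x) \<cdot> N \<subseteq> m \<cdot> N"
    using x m_ideal by (intro ideal_prod_mono cgenideal_minimal) auto
  from ideal_length_mono[OF this order_refl[of N], of R]
  have "ideal_length R (m \<cdot> N) N \<le> enat n" unfolding xN .
  have "\<exists>j\<in>U. g j \<in> Idl (m \<cdot> N \<union> g ` (U - {j}))"
  proof (rule ccontr)
    assume none: "\<not> ?thesis"
    have "enat (card U) \<le> ideal_length R (m \<cdot> N) N"
    proof (rule ideal_length_irredundant[OF U(2) mN N _ gN])
      show "m \<cdot> N \<subseteq> N" using ideal_prod_inter[OF m_ideal N] by blast
    qed (use none in blast)
    hence "enat (Suc n) \<le> enat n"
      using \<open>ideal_length R (m \<cdot> N) N \<le> enat n\<close> unfolding U(3) by (rule order_trans)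
    thus False by simp
  qed
  then obtain j where j: "j \<in> U" "g j \<in> Idl (m \<cdot> N \<union> g ` (U - {j}))" by blast
  define N' where "N' = Idl (g ` (U - {j}))"
  have N': "ideal N' R" unfolding N'_def using gc by (intro genideal_ideal) auto
  have gN': "g ` (U - {j}) \<subseteq> N'" unfolding N'_def using gc by (intro genideal_self) auto
  have "N' = N"
  proof (rule nakayama[OF N N'])
    show "N' \<subseteq> N" unfolding N'_def using gN by (intro genideal_minimal[OF N]) auto
    have id: "ideal (N' <+> m \<cdot> N) R" by (rule add_ideals[OF N' mN])
    have up: "N' \<subseteq> N' <+> m \<cdot> N" "m \<cdot> N \<subseteq> N' <+> m \<cdot> N" by (rule add_ideals_upper[OF N' mN])+
    have "Idl (m \<cdot> N \<union> g ` (U - {j})) \<subseteq> N' <+> m \<cdot> N"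
      using up gN' by (intro genideal_minimal[OF id]) auto
    hence "g ` U \<subseteq> N' <+> m \<cdot> N" using j(2) gN' up by blast
    from genideal_minimal[OF id this] show "N \<subseteq> N' <+> m \<cdot> N" unfolding N_def[symmetric] .
  qed
  have Zj: "ideal (PIdl (z j)) R" by (rule cgenideal_ideal[OF zc[OF j(1)]])
  have pow: "ideal (ideal_pow R ?K k) R" for k by (rule ideal_pow_ideal[OF K])
  let ?T = "(PIdl (z j)) \<cdot> ideal_pow R ?K (n - 1)"
  have T: "ideal ?T R" by (rule ideal_prod_is_ideal[OF Zj pow])
  have "g ` (U - {j}) \<subseteq> ?T"
  proof
    fix s assume "s \<in> g ` (U - {j})"
    then obtain i where i: "i \<in> U" "i \<noteq> j" "s = g i" by blast
    let ?V = "U - {i} - {j}"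
    have "U - {i} = insert j ?V" using i j by auto
    moreover have "finprod R z (insert j ?V) = z j \<otimes> finprod R z ?V"
      using U zc j(1) by (intro finprod_insert) auto
    ultimately have "s = z j \<otimes> finprod R z ?V" using i(3) unfolding g_def by simp
    moreover have "card ?V = n - 1" using U i j by simp
    moreover have "finprod R z ?V \<in> ideal_pow R ?K (card ?V)"
      using U zK by (intro finprod_mem_ideal_pow K) auto
    ultimately show "s \<in> ?T" using mem_PIdl_prod_iff[OF zc[OF j(1)] pow] by auto
  qed
  hence "N' \<subseteq> ?T" unfolding N'_def by (rule genideal_minimal[OF T])
  hence gT: "g j \<in> ?T" using \<open>N' = N\<close> gN j(1) by blast
  have "ideal_pow R ?K (card (U - {j}))
      \<subseteq> (PIdl (z j)) \<cdot> ideal_pow R ?K (card (U - {j}) - 1) <+> PIdl (finprod R z (U - {j}))"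
  proof (rule ideal_pow_subset_product[OF _ K])
    fix i assume i: "i \<in> U - {j}"
    have Zi: "ideal (PIdl (z i)) R" using zc i by (intro cgenideal_ideal) auto
    show "?K \<subseteq> PIdl (z j) <+> PIdl (z i)"
      using add_ideals_upper[OF Zj Zi] cgenideal_self zc i j(1)
      by (intro K_subset[OF add_ideals[OF Zj Zi], of j i]) auto
  qed (use U zK j in auto)
  moreover have "card (U - {j}) = n" using U j by simp
  ultimately have "ideal_pow R ?K n \<subseteq> ?T <+> PIdl (g j)" unfolding g_def by simp
  also have "\<dots> \<subseteq> ?T" using T gT by (intro add_ideals_least cgenideal_minimal) auto
  finally have "ideal_pow R ?K (Suc (n - 1)) \<subseteq> ?T" using \<open>n \<noteq> 0\<close> by simp
  moreover have "PIdl (z j) \<subseteq> ?K" by (rule cgenideal_minimal[OF K zK[OF j(1)]])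
  ultimately have "is_reduction (PIdl (z j)) ?K"
    unfolding is_reduction_def using Zj K by blast
  thus ?thesis using zc[OF j(1)] by blast
qed

end

context noetherian_local_ring
begin

text \<open>The generators are absorbed into the reduction one at a time, using that reductions are transitive
and stable under adding an ideal. The regular element \<open>x\<close> keeps the reducing element regular, which
is what the next step requires.\<close>

lemma exists_principal_reduction:
  assumes inf: "infinite (carrier (R Quot m))" and dim: "krull_dim R \<le> 1"
    and x: "regular_element x" "x \<in> m" and T: "finite T" "T \<subseteq> m"
  shows "\<exists>z. regular_element z \<and> is_reduction (PIdl z) (Idl (insert x T))"
  using T
proof (induction T)
  case empty
  have X: "ideal (PIdl x) R" using x m_subset by (intro cgenideal_ideal) auto
  have "ideal_pow R (PIdl x) (Suc 0) \<subseteq> (PIdl x) \<cdot> ideal_pow R (PIdl x) 0"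
    by (simp add: ideal_pow_Suc)
  hence "is_reduction (PIdl x) (PIdl x)" unfolding is_reduction_def using X by blast
  moreover have "PIdl x = Idl {x}" using x(2) m_subset by (intro cgenideal_eq_genideal) auto
  ultimately show ?case using x(1) by metis
next
  case (insert y T)
  define K where "K = Idl (insert x T)"
  obtain z where z: "regular_element z" "is_reduction (PIdl z) K"
    using insert unfolding K_def by auto
  have xT: "insert x T \<subseteq> m" "insert x (insert y T) \<subseteq> carrier R" and yc: "y \<in> carrier R"
    using insert.prems x m_subset by auto
  have K: "ideal K R" "insert x T \<subseteq> K" "K \<subseteq> m"
    unfolding K_def using xT genideal_ideal[of "insert x T"] genideal_self[of "insert x T"]
      genideal_minimal[OF m_ideal, of "insert x T"] by simp_all
  have Y: "ideal (PIdl y) R" using yc by (rule cgenideal_ideal)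
  have zc: "z \<in> carrier R" using z by (simp add: regular_element_def)
  have zK: "z \<in> K" using z(2) cgenideal_self[OF zc] unfolding is_reduction_def by blast
  obtain w where w: "w \<in> carrier R" "is_reduction (PIdl w) (PIdl z <+> PIdl y)"
    using exists_reduction_of_two_generated[OF inf z(1) _ yc]
      prime_containing_regular_element[OF dim z(1)] zK K(3) by blast
  have red: "is_reduction (PIdl w) (K <+> PIdl y)"
    using is_reduction_trans[OF w(2) is_reduction_add[OF z(2) Y]] .
  have KY: "ideal (K <+> PIdl y) R" "K \<subseteq> K <+> PIdl y" "PIdl y \<subseteq> K <+> PIdl y"
    using add_ideals[OF K(1) Y] add_ideals_upper[OF K(1) Y] by auto
  have "K <+> PIdl y = Idl (insert x (insert y T))"
  proof
    have id: "ideal (Idl (insert x (insert y T))) R" using xT(2) by (rule genideal_ideal)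
    have "K \<subseteq> Idl (insert x (insert y T))"
      unfolding K_def using xT(2) by (intro subset_Idl_subset) auto
    moreover have "PIdl y \<subseteq> Idl (insert x (insert y T))"
      using genideal_self[OF xT(2)] by (intro cgenideal_minimal[OF id]) auto
    ultimately show "K <+> PIdl y \<subseteq> Idl (insert x (insert y T))"
      by (rule add_ideals_least[OF id])
    show "Idl (insert x (insert y T)) \<subseteq> K <+> PIdl y"
      using KY K(2) cgenideal_self[OF yc] by (intro genideal_minimal) auto
  qed
  moreover have "regular_element w"
    using reduction_generator_regular[OF red w(1) _ x(1)] K(2) KY(2) by blast
  ultimately show ?case using red by auto
qed

lemma exists_principal_reduction_of_m:
  assumes inf: "infinite (carrier (R Quot m))" and dim: "krull_dim R \<le> 1"
    and depth: "ring_depth R m \<noteq> 0"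
  shows "\<exists>z\<in>m. regular_element z \<and> is_reduction (PIdl z) m"
proof -
  obtain x where x: "x \<in> m" "regular_element x"
    using exists_regular_element_in_m[OF depth] by blast
  obtain T where T: "T \<subseteq> carrier R" "finite T" "m = Idl T"
    using finetely_gen[OF m_ideal] by blast
  have Tm: "T \<subseteq> m" unfolding T(3) using T(1) by (rule genideal_self)
  have "Idl (insert x T) = m"
  proof
    show "Idl (insert x T) \<subseteq> m" using x Tm by (intro genideal_minimal[OF m_ideal]) auto
    have "Idl T \<subseteq> Idl (insert x T)" using x(1) T(1) m_subset by (intro subset_Idl_subset) auto
    thus "m \<subseteq> Idl (insert x T)" using T(3) by simp
  qed
  then obtain z where z: "regular_element z" "is_reduction (PIdl z) m"
    using exists_principal_reduction[OF inf dim x(2,1) T(2) Tm] by auto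
  moreover have "z \<in> m"
    using z cgenideal_self[of z] unfolding is_reduction_def regular_element_def by blast
  ultimately show ?thesis by blast
qed

end

section \<open>Multiplicity and number of generators\<close>

context noetherian_local_ring
begin

lemma prime_containing_pow_m:
  assumes P: "primeideal P R" and sub: "ideal_pow R m n \<subseteq> P"
  shows "P = m"
proof -
  interpret P: primeideal P R by fact
  have "P \<subseteq> m" using proper_ideal_subset_m[OF P.is_ideal] P.I_notcarr by blast
  moreover have "m \<subseteq> P"
    using sub
  proof (induction n)
    case 0
    thus ?case using P.I_notcarr P.a_subset by auto
  next
    case (Suc n)
    thus ?case
      using primeideal_divides_ideal_prod[OF P m_ideal ideal_pow_ideal[OF m_ideal, of n]]
      unfolding ideal_pow_Suc by blast
  qed
  ultimately show ?thesis by blast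
qed

text \<open>From some exponent on, \<open>m\<^sup>n\<^sup>+\<^sup>1 = z m\<^sup>n\<close>, so each further step of the \<open>m\<close>-adic filtration has the length
of \<open>m\<^sup>n/z m\<^sup>n\<close>, which is that of \<open>R/zR\<close>. Thus the length of \<open>R/m\<^sup>n\<close> is eventually affine in \<open>n\<close> with
slope \<open>e\<close>.\<close>

lemma hs_multiplicity_principal_reduction:
  assumes dim: "krull_dim R = 1" and z: "regular_element z" "is_reduction (PIdl z) m"
    and e: "ideal_length R (PIdl z) (carrier R) = enat e"
  shows "hs_multiplicity R m = real e"
proof -
  have pow: "ideal (ideal_pow R m n) R" for n by (rule ideal_pow_ideal[OF m_ideal])
  have fin: "ideal_length R (ideal_pow R m n) (carrier R) \<noteq> \<infinity>" for n
    by (rule finite_colength[OF pow]) (rule prime_containing_pow_m)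
  define f where "f n = the_enat (ideal_length R (ideal_pow R m n) (carrier R))" for n
  have f: "ideal_length R (ideal_pow R m n) (carrier R) = enat (f n)" for n
    unfolding f_def using fin[of n] by auto
  obtain r where r: "ideal_pow R m (Suc r) \<subseteq> (PIdl z) \<cdot> ideal_pow R m r"
    using z(2) unfolding is_reduction_def by blast
  have Z: "ideal (PIdl z) R" "PIdl z \<subseteq> m" using z(2) unfolding is_reduction_def by auto
  have step: "ideal_pow R m (Suc (r + k)) = (PIdl z) \<cdot> ideal_pow R m (r + k)" for k
  proof
    show "(PIdl z) \<cdot> ideal_pow R m (r + k) \<subseteq> ideal_pow R m (Suc (r + k))"
      unfolding ideal_pow_Suc using Z by (intro ideal_prod_mono order_refl)
    show "ideal_pow R m (Suc (r + k)) \<subseteq> (PIdl z) \<cdot> ideal_pow R m (r + k)"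
    proof (induction k)
      case (Suc k)
      have "ideal_pow R m (Suc (r + Suc k)) = m \<cdot> ideal_pow R m (Suc (r + k))"
        by (simp add: ideal_pow_Suc)
      also have "\<dots> \<subseteq> m \<cdot> ((PIdl z) \<cdot> ideal_pow R m (r + k))"
        using Suc by (rule ideal_prod_mono[OF order_refl])
      also have "\<dots> = (PIdl z) \<cdot> (m \<cdot> ideal_pow R m (r + k))"
        by (rule ideal_prod_left_commute[OF m_ideal Z(1) pow])
      finally show ?case by (simp add: ideal_pow_Suc)
    qed (use r in simp)
  qed
  have f_step: "f (Suc (r + k)) = f (r + k) + e" for k
  proof -
    let ?N = "ideal_pow R m (r + k)"
    have "enat (f (Suc (r + k))) = ideal_length R ((PIdl z) \<cdot> ?N) (carrier R)"
      using f[of "Suc (r + k)"] step[of k] by simp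
    also have "\<dots> = ideal_length R ((PIdl z) \<cdot> ?N) ?N + ideal_length R ?N (carrier R)"
      by (rule ideal_length_add) (use Z pow oneideal ideal_prod_is_ideal[OF Z(1) pow]
        ideal_prod_inter[OF Z(1) pow] additive_subgroup.a_subset[OF ideal.axioms(1)[OF pow]] in auto)
    also have "\<dots> = enat (e + f (r + k))"
      using ideal_length_regular_multiple[OF z(1) pow fin] e f by simp
    finally show ?thesis by simp
  qed
  \<comment> \<open>Hence \<open>f n = (f r - r e) + n e\<close> for \<open>n \<ge> r\<close>.\<close>
  have f_eq: "f (r + k) = f r + k * e" for k
    by (induction k) (simp_all add: f_step)
  have "\<forall>\<^sub>F n in sequentially. real e + (real (f r) - real r * real e) / real n = real (f n) / real n"
  proof (rule eventually_sequentiallyI[of "Suc r"])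
    fix n assume n: "Suc r \<le> n"
    then obtain k where "n = r + k" using nat_le_iff_add[of r n] by auto
    thus "real e + (real (f r) - real r * real e) / real n = real (f n) / real n"
      using n f_eq[of k] by (simp add: field_simps)
  qed
  moreover have "(\<lambda>n. real e + (real (f r) - real r * real e) / real n) \<longlonglongrightarrow> real e + 0"
    by (intro tendsto_add tendsto_const lim_const_over_n)
  ultimately have "(\<lambda>n. real (f n) / real n) \<longlonglongrightarrow> real e"
    using Lim_transform_eventually by fastforce
  hence "lim (\<lambda>n. real (f n) / real n) = real e" by (rule limI)
  thus ?thesis
    unfolding hs_multiplicity_def dim
    by (simp add: one_enat_def Let_def module_length_quot_ring_module[OF pow] f)
qed

text \<open>A generating set of minimal cardinality is irredundant over \<open>mI\<close> by Nakayama's lemma.\<close>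

lemma ideal_mu_le_ideal_length:
  assumes I: "ideal I R"
  shows "enat (ideal_mu R I) \<le> ideal_length R (m \<cdot> I) I"
proof -
  let ?Q = "\<lambda>n. \<exists>S. S \<subseteq> carrier R \<and> finite S \<and> card S = n \<and> Idl S = I"
  have "\<exists>n. ?Q n" using finetely_gen[OF I] by blast
  hence "?Q (ideal_mu R I)" unfolding ideal_mu_def by (rule LeastI_ex)
  then obtain S where S: "S \<subseteq> carrier R" "finite S" "card S = ideal_mu R I" "Idl S = I" by blast
  have mI: "ideal (m \<cdot> I) R" by (rule ideal_prod_is_ideal[OF m_ideal I])
  have SI: "S \<subseteq> I" using genideal_self[OF S(1)] S(4) by simp
  have "enat (card S) \<le> ideal_length R (m \<cdot> I) I"
  proof (rule ideal_length_irredundant[where g = "\<lambda>s. s", OF S(2) mI I])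
    show "m \<cdot> I \<subseteq> I" using ideal_prod_inter[OF m_ideal I] by blast
    show "(\<lambda>s. s) ` S \<subseteq> I" using SI by simp
  next
    fix s assume s: "s \<in> S"
    show "s \<notin> Idl (m \<cdot> I \<union> (\<lambda>s. s) ` (S - {s}))"
    proof
      assume "s \<in> Idl (m \<cdot> I \<union> (\<lambda>s. s) ` (S - {s}))"
      hence s_mem: "s \<in> Idl (m \<cdot> I \<union> (S - {s}))" by simp
      define N where "N = Idl (S - {s})"
      have N: "ideal N R" "S - {s} \<subseteq> N"
        unfolding N_def using S(1) genideal_ideal[of "S - {s}"] genideal_self[of "S - {s}"] by auto
      have T: "ideal (N <+> m \<cdot> I) R" "N \<subseteq> N <+> m \<cdot> I" "m \<cdot> I \<subseteq> N <+> m \<cdot> I"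
        using add_ideals[OF N(1) mI] add_ideals_upper[OF N(1) mI] by auto
      have "Idl (m \<cdot> I \<union> (S - {s})) \<subseteq> N <+> m \<cdot> I"
        using T N by (intro genideal_minimal) auto
      hence "S \<subseteq> N <+> m \<cdot> I" using s_mem T N by blast
      hence "I \<subseteq> N <+> m \<cdot> I" using genideal_minimal[OF T(1)] S(4) by blast
      moreover have "N \<subseteq> I" unfolding N_def using SI by (intro genideal_minimal[OF I]) auto
      ultimately have "N = I" using nakayama[OF I N(1)] by blast
      hence "?Q (card (S - {s}))" using S unfolding N_def by blast
      hence "ideal_mu R I \<le> card (S - {s})" unfolding ideal_mu_def by (rule Least_le)
      thus False using S(2,3) s by (metis card_Diff1_less not_le)
    qed
  qed
  thus ?thesis using S(3) by simp
qed

end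

section \<open>Ulrich ideals are Burch\<close>

context noetherian_local_ring
begin

lemma prime_containing_primary_ideal:
  assumes I: "ideal_primary_to R m I" and P: "primeideal P R" "I \<subseteq> P"
  shows "P = m"
proof -
  interpret P: primeideal P R by fact
  have "m \<subseteq> P"
  proof
    fix a assume "a \<in> m"
    then obtain n :: nat where a: "a \<in> carrier R" "a [^] n \<in> P"
      using I P(2) unfolding ideal_primary_to_def ideal_radical_def by blast
    from a(2) show "a \<in> P"
    proof (induction n)
      case 0
      thus ?case using P.one_imp_carrier P.I_notcarr by simp
    next
      case (Suc n)
      thus ?case using P.I_prime[of "a [^] n" a] a(1) by auto
    qed
  qed
  moreover have "P \<subseteq> m" using proper_ideal_subset_m[OF P.is_ideal] P.I_notcarr by blast
  ultimately show ?thesis by blast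
qed

text \<open>In the tower \<open>zI \<subseteq> mI \<subseteq> I\<close> the whole has length \<open>e\<close>, the multiplicity of \<open>R\<close>, and the upper step has
length at least the number of generators of \<open>I\<close>, again \<open>e\<close>. Nothing remains for the lower step.\<close>

lemma ulrich_ideal_multiple:
  assumes dim: "krull_dim R = 1" and z: "regular_element z" "is_reduction (PIdl z) m"
    and I: "ulrich_ideal R m I"
  shows "m \<cdot> I = (PIdl z) \<cdot> I"
proof -
  have prim: "ideal_primary_to R m I" and mu: "real (ideal_mu R I) = hs_multiplicity R m"
    using I unfolding ulrich_ideal_def by auto
  have id: "ideal I R" using prim unfolding ideal_primary_to_def primary_ideal_def by blast
  have zc: "z \<in> carrier R" using z(1) by (simp add: regular_element_def)
  have Z: "ideal (PIdl z) R" "PIdl z \<subseteq> m" using z(2) unfolding is_reduction_def by auto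
  have "ideal_length R (PIdl z) (carrier R) \<noteq> \<infinity>"
  proof (rule finite_colength[OF Z(1)])
    fix P assume "primeideal P R" "PIdl z \<subseteq> P"
    thus "P = m"
      using prime_containing_regular_element[OF _ z(1)] dim cgenideal_self[OF zc] by auto
  qed
  then obtain e where e: "ideal_length R (PIdl z) (carrier R) = enat e" by auto
  have "ideal_mu R I = e"
    using mu hs_multiplicity_principal_reduction[OF dim z e] by simp
  hence mu_le: "enat e \<le> ideal_length R (m \<cdot> I) I" using ideal_mu_le_ideal_length[OF id] by simp
  have mI: "ideal (m \<cdot> I) R" and zI: "ideal ((PIdl z) \<cdot> I) R"
    using ideal_prod_is_ideal m_ideal Z(1) id by auto
  have sub: "(PIdl z) \<cdot> I \<subseteq> m \<cdot> I" using Z(2) by (rule ideal_prod_mono) simp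
  have "ideal_length R ((PIdl z) \<cdot> I) (m \<cdot> I) + ideal_length R (m \<cdot> I) I
      = ideal_length R ((PIdl z) \<cdot> I) I"
    using ideal_prod_inter[OF m_ideal id] by (intro ideal_length_add[symmetric] zI mI id sub) auto
  also have "\<dots> = enat e"
    using ideal_length_regular_multiple[OF z(1) id] e
      finite_colength[OF id prime_containing_primary_ideal[OF prim]] by simp
  finally have "ideal_length R ((PIdl z) \<cdot> I) (m \<cdot> I) = 0"
    using mu_le by (cases "ideal_length R ((PIdl z) \<cdot> I) (m \<cdot> I)"; cases "ideal_length R (m \<cdot> I) I")
      (auto simp: zero_enat_def)
  hence "\<not> (PIdl z) \<cdot> I \<subset> m \<cdot> I" using ideal_length_pos[OF zI mI] by auto
  thus ?thesis using sub by blast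
qed

text \<open>If \<open>b\<close> represents a nonzero socle element of \<open>R/I\<close>, then \<open>z b\<close> lies in \<open>m (I : m)\<close>. It is not in
\<open>zI = mI\<close>, since \<open>z\<close> can be cancelled and \<open>b \<notin> I\<close>.\<close>

lemma burch_ideal_if_multiple:
  assumes I: "ideal_primary_to R m I" and z: "regular_element z" "z \<in> m"
    and eq: "m \<cdot> I = (PIdl z) \<cdot> I"
  shows "burch_ideal R m I"
proof -
  have id: "ideal I R" "I \<noteq> carrier R"
    using I unfolding ideal_primary_to_def primary_ideal_def by auto
  have zc: "z \<in> carrier R" using z(1) by (simp add: regular_element_def)
  obtain b where b: "b \<in> carrier R" "b \<notin> I" "\<And>r. r \<in> m \<Longrightarrow> r \<otimes> b \<in> I"
    using socle_element[OF id prime_containing_primary_ideal[OF I]] by blast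
  have "b \<in> ideal_colon R I m"
    using b m_subset by (auto simp: ideal_colon_def m_comm subset_iff)
  hence "z \<otimes> b \<in> m \<cdot> ideal_colon R I m" using z(2) by (intro ideal_prod.prod)
  moreover have "z \<otimes> b \<notin> m \<cdot> I"
  proof
    assume "z \<otimes> b \<in> m \<cdot> I"
    then obtain a where a: "a \<in> I" "z \<otimes> b = z \<otimes> a"
      unfolding eq using mem_PIdl_prod_iff[OF zc id(1)] by blast
    hence "b = a" using regular_element_cancel[OF z(1)] b(1) ideal.Icarr[OF id(1)] by blast
    thus False using a b by blast
  qed
  ultimately show ?thesis unfolding burch_ideal_def using id(1) by auto
qed

end

theorem proposition3p18:
  fixes R :: "('a, 'c) ring_scheme" and m I :: "'a set"
  assumes "noetherian_local_ring R m"
    and "krull_dim R = 1"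
    and "cohen_macaulay R m"
    and "infinite (carrier (R Quot m))"
    and "ideal I R"
    and "I \<noteq> {\<zero>\<^bsub>R\<^esub>}"
    and "ulrich_ideal R m I"
    and "elias_ideal R m I"
  shows "burch_ideal R m I"
proof -
  interpret noetherian_local_ring R m by fact
  have "ring_depth R m \<noteq> 0" using assms(2,3) by (simp add: cohen_macaulay_def)
  then obtain z where z: "z \<in> m" "regular_element z" "is_reduction (PIdl\<^bsub>R\<^esub> z) m"
    using exists_principal_reduction_of_m[OF assms(4)] assms(2) by auto
  show ?thesis
    using burch_ideal_if_multiple[OF _ z(2,1) ulrich_ideal_multiple[OF assms(2) z(2,3) assms(7)]]
      assms(7) unfolding ulrich_ideal_def by blast
qed

end
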